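(* Let $\Omega$ be a bounded spatial domain with sufficiently regular boundary, $T>0$, $0<\alpha<1$, and let $\lambda_1>0$ be the minimal eigenvalue of $-\Delta\omega=\lambda\omega$ in $\Omega$, $\omega=0$ on $\partial\Omega$. Let $\kappa<\lambda_1$. Let $u$ be the solution of $$\partial_t u-\Delta u=\kappa u+f\ \text{ in }\Omega\times(0,T],\qquad u=0\ \text{ on }\partial\Omega\times[0,T],\qquad u(\cdot,0)=u_0,$$ and suppose that $\|\partial_t^k u(t)\|\le M t^{\alpha-k}$ for $k=1,2,3$ and $0<t\le T$, with some constant $M$. Let $N\ge2$ be an integer, $\tau=T/N$, $t_n=n\tau$, and let $U^n$ be given by the implicit Euler semi-discrete scheme $$\frac{U^n-U^{n-1}}{\tau}=\Delta U^n+\kappa U^n+f(t_n)\ \text{ in }\Omega,\qquad U^n=0\ \text{ on }\partial\Omega,\qquad 1\le n\le N,\qquad U^0=u_0.$$ Let $e^n=u(\cdot,t_n)-U^n$. Then there is a constant $C_{u,\alpha}>0$ depending only on $\alpha$ and $M$ such that, whenever $\tau<1/(\lambda_1-\kappa)$, for all $2\le n\le N$, $$\|e^n\|\le e^{-(\lambda_1-\kappa)t_n/2}\|e^{0}\|+C_{u,\alpha}\Big(C_7e^{-(\lambda_1-\kappa)t_n/4}\tau^\alpha+C_8\,t_{n-1}^{\alpha-1}\tau\Big),$$ where $C_7:=\frac{2}{1-\alpha}+3e^{-(\lambda_1-\kappa)t_n/4}$ and $$C_8:=\begin{cases}\frac{1}{1-\alpha}\big(2^{1-\alpha}(1-e^{-(\lambda_1-\kappa)t_n/4})-1\big),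 & t_n>-\frac{4}{\lambda_1-\kappa}\ln(1-2^{\alpha-1}),\\ 0,& t_n\le -\frac{4}{\lambda_1-\kappa}\ln(1-2^{\alpha-1}).\end{cases}$$
   Context: $\|\cdot\|$ denotes the $L^2(\Omega)$ norm. The Dirichlet eigenvalue problem has a nondecreasing sequence of positive eigenvalues $\lambda_1\le\lambda_2\le\cdots\to\infty$ whose eigenfunctions form an orthonormal basis of $L^2(\Omega)$. The solution $u$ is continuous from $[0,T]$ into $L^2(\Omega)$ and, on $(0,T]$, three times continuously differentiable in time with values in $L^2(\Omega)$, with $u(t)$ in the domain of the Dirichlet Laplacian; $f$ is the corresponding given source term, and $U^n$ for $n\ge1$ lies in the domain of the Dirichlet Laplacian. The constant $C_{u,\alpha}$ is independent of $n$, $N$, $\tau$, $T$, $\kappa$ and $\Omega$. *)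

theory Defs
  imports "HOL-Analysis.Analysis"
begin

text \<open>Elements of \<open>L\<^sup>2\<close> are represented by functions; equality of elements is equality
  almost everywhere.\<close>

definition L2_space :: "'x measure \<Rightarrow> ('x \<Rightarrow> real) set" where
  "L2_space \<mu> = {w \<in> borel_measurable \<mu>. integrable \<mu> (\<lambda>x. (w x)\<^sup>2)}"

definition L2_inner :: "'x measure \<Rightarrow> ('x \<Rightarrow> real) \<Rightarrow> ('x \<Rightarrow> real) \<Rightarrow> real" where
  "L2_inner \<mu> v w = (\<integral>x. v x * w x \<partial>\<mu>)"

definition L2_norm :: "'x measure \<Rightarrow> ('x \<Rightarrow> real) \<Rightarrow> real" where
  "L2_norm \<mu> w = sqrt (\<integral>x. (w x)\<^sup>2 \<partial>\<mu>)"

definition L2_continuous_on :: "'x measure \<Rightarrow> real set \<Rightarrow> (real \<Rightarrow> 'x \<Rightarrow> real) \<Rightarrow> bool" where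
  "L2_continuous_on \<mu> I v \<longleftrightarrow>
     (\<forall>t\<in>I. v t \<in> L2_space \<mu>) \<and>
     (\<forall>t\<in>I. ((\<lambda>s. L2_norm \<mu> (\<lambda>x. v s x - v t x)) \<longlongrightarrow> 0) (at t within I))"

definition L2_has_derivative_on ::
  "'x measure \<Rightarrow> real set \<Rightarrow> (real \<Rightarrow> 'x \<Rightarrow> real) \<Rightarrow> (real \<Rightarrow> 'x \<Rightarrow> real) \<Rightarrow> bool" where
  "L2_has_derivative_on \<mu> I v v' \<longleftrightarrow>
     (\<forall>t\<in>I. v t \<in> L2_space \<mu> \<and> v' t \<in> L2_space \<mu>) \<and>
     (\<forall>t\<in>I. ((\<lambda>s. L2_norm \<mu> (\<lambda>x. (v s x - v t x) / (s - t) - v' t x)) \<longlongrightarrow> 0) (at t within I))"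

definition L2_time_derivatives ::
  "'x measure \<Rightarrow> real set \<Rightarrow> nat \<Rightarrow> (real \<Rightarrow> 'x \<Rightarrow> real) \<Rightarrow> (nat \<Rightarrow> real \<Rightarrow> 'x \<Rightarrow> real) \<Rightarrow> bool" where
  "L2_time_derivatives \<mu> I m v D \<longleftrightarrow>
     D 0 = v \<and>
     (\<forall>k<m. L2_has_derivative_on \<mu> I (D k) (D (Suc k))) \<and>
     L2_continuous_on \<mu> I (D m)"

definition L2_orthonormal_basis :: "'x measure \<Rightarrow> (nat \<Rightarrow> 'x \<Rightarrow> real) \<Rightarrow> bool" where
  "L2_orthonormal_basis \<mu> \<omega> \<longleftrightarrow>
     (\<forall>j. \<omega> j \<in> L2_space \<mu>) \<and>
     (\<forall>i j. L2_inner \<mu> (\<omega> i) (\<omega> j) = (if i = j then 1 else 0)) \<and>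
     (\<forall>w\<in>L2_space \<mu>.
        (\<lambda>m. L2_norm \<mu> (\<lambda>x. w x - (\<Sum>j<m. L2_inner \<mu> w (\<omega> j) * \<omega> j x))) \<longlonglongrightarrow> 0)"

text \<open>Points of \<open>\<real>\<^sup>d\<close> are the functions in \<open>{..<d} \<rightarrow>\<^sub>E UNIV\<close>, which is both the carrier of the
  product topology and the space of the product measure below. The dimension is a number and not
  a type, so that one constant can be asserted to serve all dimensions.\<close>

abbreviation euclidean_top :: "nat \<Rightarrow> (nat \<Rightarrow> real) topology" where
  "euclidean_top d \<equiv> product_topology (\<lambda>_. euclideanreal) {..<d}"

definition bounded_domain :: "nat \<Rightarrow> (nat \<Rightarrow> real) set \<Rightarrow> bool" where
  "bounded_domain d \<Omega> \<longleftrightarrow>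
     \<Omega> \<noteq> {} \<and> openin (euclidean_top d) \<Omega> \<and> connectedin (euclidean_top d) \<Omega> \<and>
     (\<exists>r. \<forall>x\<in>\<Omega>. \<forall>i<d. \<bar>x i\<bar> \<le> r)"

definition lebesgue_dom :: "nat \<Rightarrow> (nat \<Rightarrow> real) set \<Rightarrow> (nat \<Rightarrow> real) measure" where
  "lebesgue_dom d \<Omega> = restrict_space (completion (\<Pi>\<^sub>M i\<in>{..<d}. lborel)) \<Omega>"

definition partial :: "nat \<Rightarrow> ((nat \<Rightarrow> real) \<Rightarrow> real) \<Rightarrow> (nat \<Rightarrow> real) \<Rightarrow> real" where
  "partial i \<phi> x = deriv (\<lambda>s. \<phi> (x(i := s))) (x i)"

fun cont_diff :: "nat \<Rightarrow> nat \<Rightarrow> ((nat \<Rightarrow> real) \<Rightarrow> real) \<Rightarrow> bool" where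
  "cont_diff d 0 \<phi> \<longleftrightarrow> continuous_map (euclidean_top d) euclideanreal \<phi>"
| "cont_diff d (Suc k) \<phi> \<longleftrightarrow>
     continuous_map (euclidean_top d) euclideanreal \<phi> \<and>
     (\<forall>i<d. \<forall>x\<in>topspace (euclidean_top d).
        (\<lambda>s. \<phi> (x(i := s))) field_differentiable at (x i)) \<and>
     (\<forall>i<d. cont_diff d k (partial i \<phi>))"

definition test_function :: "nat \<Rightarrow> (nat \<Rightarrow> real) set \<Rightarrow> ((nat \<Rightarrow> real) \<Rightarrow> real) \<Rightarrow> bool" where
  "test_function d \<Omega> \<phi> \<longleftrightarrow>
     (\<forall>k. cont_diff d k \<phi>) \<and>
     (\<exists>K\<subseteq>\<Omega>. compactin (euclidean_top d) K \<and> (\<forall>x\<in>topspace (euclidean_top d) - K. \<phi> x = 0))"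

text \<open>\<open>w\<close> belongs to \<open>H\<^sup>1\<^sub>0\<close>, the closure of the test functions in the \<open>H\<^sup>1\<close> norm, and \<open>G i\<close> is its
  weak derivative in direction \<open>i\<close> (the mean-square limit of the derivatives of the
  approximating test functions).\<close>

definition H10_gradient ::
  "nat \<Rightarrow> (nat \<Rightarrow> real) set \<Rightarrow> ((nat \<Rightarrow> real) \<Rightarrow> real) \<Rightarrow> (nat \<Rightarrow> (nat \<Rightarrow> real) \<Rightarrow> real) \<Rightarrow> bool" where
  "H10_gradient d \<Omega> w G \<longleftrightarrow>
     w \<in> L2_space (lebesgue_dom d \<Omega>) \<and>
     (\<forall>i<d. G i \<in> L2_space (lebesgue_dom d \<Omega>)) \<and>
     (\<exists>\<psi>. (\<forall>m. test_function d \<Omega> (\<psi> m)) \<and>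
        (\<lambda>m. L2_norm (lebesgue_dom d \<Omega>) (\<lambda>x. \<psi> m x - w x)) \<longlonglongrightarrow> 0 \<and>
        (\<forall>i<d. (\<lambda>m. L2_norm (lebesgue_dom d \<Omega>) (\<lambda>x. partial i (\<psi> m) x - G i x)) \<longlonglongrightarrow> 0))"

text \<open>\<open>w\<close> lies in the domain of the Dirichlet Laplacian and \<open>\<Delta> w = g\<close>: \<open>w\<close> is in \<open>H\<^sup>1\<^sub>0\<close> (which
  encodes \<open>w = 0\<close> on the boundary), \<open>g\<close> is in \<open>L\<^sup>2\<close>, and the equation holds weakly. On domains
  with sufficiently regular boundary this domain is the intersection of \<open>H\<^sup>2\<close> and \<open>H\<^sup>1\<^sub>0\<close>.\<close>

definition dirichlet_laplacian ::
  "nat \<Rightarrow> (nat \<Rightarrow> real) set \<Rightarrow> ((nat \<Rightarrow> real) \<Rightarrow> real) \<Rightarrow> ((nat \<Rightarrow> real) \<Rightarrow> real) \<Rightarrow> bool" where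
  "dirichlet_laplacian d \<Omega> w g \<longleftrightarrow>
     g \<in> L2_space (lebesgue_dom d \<Omega>) \<and>
     (\<exists>G. H10_gradient d \<Omega> w G \<and>
        (\<forall>\<phi>. test_function d \<Omega> \<phi> \<longrightarrow>
           (\<Sum>i<d. L2_inner (lebesgue_dom d \<Omega>) (G i) (partial i \<phi>)) =
             - L2_inner (lebesgue_dom d \<Omega>) g \<phi>))"

definition dirichlet_eigenpair ::
  "nat \<Rightarrow> (nat \<Rightarrow> real) set \<Rightarrow> real \<Rightarrow> ((nat \<Rightarrow> real) \<Rightarrow> real) \<Rightarrow> bool" where
  "dirichlet_eigenpair d \<Omega> l w \<longleftrightarrow>
     dirichlet_laplacian d \<Omega> w (\<lambda>x. - l * w x) \<and> \<not> (AE x in lebesgue_dom d \<Omega>. w x = 0)"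

definition minimal_dirichlet_eigenvalue :: "nat \<Rightarrow> (nat \<Rightarrow> real) set \<Rightarrow> real \<Rightarrow> bool" where
  "minimal_dirichlet_eigenvalue d \<Omega> l \<longleftrightarrow>
     (\<exists>w. dirichlet_eigenpair d \<Omega> l w) \<and> (\<forall>l' w. dirichlet_eigenpair d \<Omega> l' w \<longrightarrow> l \<le> l')"

text \<open>The classical spectral theorem provides such a basis. The theorem takes its existence as a
  standing assumption on \<open>\<Omega>\<close> and imposes no smoothness class on the boundary.\<close>

definition dirichlet_eigenbasis ::
  "nat \<Rightarrow> (nat \<Rightarrow> real) set \<Rightarrow> (nat \<Rightarrow> real) \<Rightarrow> (nat \<Rightarrow> (nat \<Rightarrow> real) \<Rightarrow> real) \<Rightarrow> bool" where
  "dirichlet_eigenbasis d \<Omega> lam \<omega> \<longleftrightarrow>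
     mono lam \<and> (\<forall>j. 0 < lam j) \<and> filterlim lam at_top sequentially \<and>
     (\<forall>j. dirichlet_eigenpair d \<Omega> (lam j) (\<omega> j)) \<and>
     L2_orthonormal_basis (lebesgue_dom d \<Omega>) \<omega>"

definition parabolic_solution ::
  "nat \<Rightarrow> (nat \<Rightarrow> real) set \<Rightarrow> real \<Rightarrow> real \<Rightarrow> (real \<Rightarrow> (nat \<Rightarrow> real) \<Rightarrow> real) \<Rightarrow>
   ((nat \<Rightarrow> real) \<Rightarrow> real) \<Rightarrow> (real \<Rightarrow> (nat \<Rightarrow> real) \<Rightarrow> real) \<Rightarrow>
   (nat \<Rightarrow> real \<Rightarrow> (nat \<Rightarrow> real) \<Rightarrow> real) \<Rightarrow> bool" where
  "parabolic_solution d \<Omega> T \<kappa> f u0 u D \<longleftrightarrow>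
     L2_continuous_on (lebesgue_dom d \<Omega>) {0..T} u \<and>
     L2_time_derivatives (lebesgue_dom d \<Omega>) {0<..T} 3 u D \<and>
     (\<forall>t\<in>{0<..T}. \<exists>\<Delta>u. dirichlet_laplacian d \<Omega> (u t) \<Delta>u \<and>
        (AE x in lebesgue_dom d \<Omega>. D 1 t x - \<Delta>u x = \<kappa> * u t x + f t x)) \<and>
     (AE x in lebesgue_dom d \<Omega>. u 0 x = u0 x)"

definition implicit_euler ::
  "nat \<Rightarrow> (nat \<Rightarrow> real) set \<Rightarrow> real \<Rightarrow> nat \<Rightarrow> real \<Rightarrow> (real \<Rightarrow> (nat \<Rightarrow> real) \<Rightarrow> real) \<Rightarrow>
   ((nat \<Rightarrow> real) \<Rightarrow> real) \<Rightarrow> (nat \<Rightarrow> (nat \<Rightarrow> real) \<Rightarrow> real) \<Rightarrow> bool" where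
  "implicit_euler d \<Omega> \<tau> N \<kappa> f u0 U \<longleftrightarrow>
     (AE x in lebesgue_dom d \<Omega>. U 0 x = u0 x) \<and>
     (\<forall>n\<in>{1..N}. \<exists>\<Delta>U. dirichlet_laplacian d \<Omega> (U n) \<Delta>U \<and>
        (AE x in lebesgue_dom d \<Omega>.
           (U n x - U (n - 1) x) / \<tau> = \<Delta>U x + \<kappa> * U n x + f (real n * \<tau>) x))"

definition C7 :: "real \<Rightarrow> real \<Rightarrow> real \<Rightarrow> real" where
  "C7 \<alpha> \<delta> t = 2 / (1 - \<alpha>) + 3 * exp (- \<delta> * t / 4)"

definition C8 :: "real \<Rightarrow> real \<Rightarrow> real \<Rightarrow> real" where
  "C8 \<alpha> \<delta> t =
     (if t > - (4 / \<delta>) * ln (1 - 2 powr (\<alpha> - 1))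
      then 1 / (1 - \<alpha>) * (2 powr (1 - \<alpha>) * (1 - exp (- \<delta> * t / 4)) - 1)
      else 0)"

end

theory Submission
  imports Defs
begin

text \<open>Expanding in the eigenbasis, the Dirichlet Laplacian satisfies \<open>\<langle>\<Delta> w, w\<rangle> \<le> - \<lambda>\<^sub>1 \<parallel>w\<parallel>\<^sup>2\<close>. Testing
  the error equation with \<open>e\<^sup>n\<close> therefore gives \<open>(1 + \<tau> \<delta>) \<parallel>e\<^sup>n\<parallel> \<le> \<parallel>e\<^sup>n\<^sup>-\<^sup>1\<parallel> + \<tau> \<parallel>R\<^sup>n\<parallel>\<close> with
  \<open>\<delta> = \<lambda>\<^sub>1 - \<kappa>\<close> and truncation error \<open>R\<^sup>n\<close>, where \<open>e\<^sup>0 = 0\<close>. The regularity assumption yields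
  \<open>\<tau> \<parallel>R\<^sup>1\<parallel> = O(\<tau>\<^sup>\<alpha>)\<close> and \<open>\<tau> \<parallel>R\<^sup>i\<^sup>+\<^sup>1\<parallel> \<le> M \<tau>\<^sup>\<alpha> i\<^sup>\<alpha>\<^sup>-\<^sup>2\<close>. In the resulting sum of
  \<open>(1 + \<tau> \<delta>) powr (i - n) * i powr (\<alpha> - 2)\<close> the terms with \<open>i \<le> n / 2\<close> carry the factor
  \<open>exp (- \<delta> t\<^sub>n / 4)\<close>, and those with \<open>i > n / 2\<close> sum to \<open>O(n\<^sup>\<alpha>\<^sup>-\<^sup>1)\<close>. Where \<open>C8\<close> vanishes or is small,
  \<open>exp (- \<delta> t\<^sub>n / 4)\<close> is bounded below, so the first term absorbs both.\<close>

section \<open>Inner products and derivatives in the space of square integrable functions\<close>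

lemma L2_norm_eq_inner: "L2_norm \<mu> w = sqrt (L2_inner \<mu> w w)"
  by (simp add: L2_norm_def L2_inner_def power2_eq_square)

lemma L2_inner_self: "L2_inner \<mu> w w = (L2_norm \<mu> w)\<^sup>2"
  unfolding L2_norm_eq_inner by (simp add: L2_inner_def)

lemma L2_norm_nonneg [simp]: "0 \<le> L2_norm \<mu> w"
  by (simp add: L2_norm_def)

lemma L2_inner_commute: "L2_inner \<mu> v w = L2_inner \<mu> w v"
  by (simp add: L2_inner_def mult.commute)

lemma L2_space_measurable [measurable_dest]: "w \<in> L2_space \<mu> \<Longrightarrow> w \<in> borel_measurable \<mu>"
  by (simp add: L2_space_def)

lemma L2_space_integrable_mult:
  assumes "v \<in> L2_space \<mu>" "w \<in> L2_space \<mu>"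
  shows "integrable \<mu> (\<lambda>x. v x * w x)"
proof (rule Bochner_Integration.integrable_bound)
  show "integrable \<mu> (\<lambda>x. (v x)\<^sup>2 + (w x)\<^sup>2)"
    using assms by (simp add: L2_space_def)
  show "(\<lambda>x. v x * w x) \<in> borel_measurable \<mu>"
    using assms by measurable
  show "AE x in \<mu>. norm (v x * w x) \<le> norm ((v x)\<^sup>2 + (w x)\<^sup>2)"
  proof (rule AE_I2)
    fix x
    have "2 * (\<bar>v x\<bar> * \<bar>w x\<bar>) \<le> (v x)\<^sup>2 + (w x)\<^sup>2"
      using sum_squares_bound[of "\<bar>v x\<bar>" "\<bar>w x\<bar>"] by (simp add: mult.assoc)
    moreover have "0 \<le> \<bar>v x\<bar> * \<bar>w x\<bar>" by simp
    ultimately show "norm (v x * w x) \<le> norm ((v x)\<^sup>2 + (w x)\<^sup>2)"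
      unfolding real_norm_def abs_mult by linarith
  qed
qed

lemma L2_space_scale: "w \<in> L2_space \<mu> \<Longrightarrow> (\<lambda>x. c * w x) \<in> L2_space \<mu>"
  by (auto simp: L2_space_def power_mult_distrib)

lemma L2_space_add:
  assumes "v \<in> L2_space \<mu>" "w \<in> L2_space \<mu>"
  shows "(\<lambda>x. v x + w x) \<in> L2_space \<mu>"
proof -
  have "integrable \<mu> (\<lambda>x. (v x)\<^sup>2 + (w x)\<^sup>2 + 2 * (v x * w x))"
    using assms L2_space_integrable_mult[OF assms]
    by (intro Bochner_Integration.integrable_add) (auto simp: L2_space_def)
  then show ?thesis
    using assms by (auto simp: L2_space_def power2_sum mult.assoc)
qed

lemma L2_space_diff:
  assumes "v \<in> L2_space \<mu>" "w \<in> L2_space \<mu>"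
  shows "(\<lambda>x. v x - w x) \<in> L2_space \<mu>"
  using L2_space_add[OF assms(1) L2_space_scale[OF assms(2), of "-1"]] by simp

lemma L2_space_divide: "w \<in> L2_space \<mu> \<Longrightarrow> (\<lambda>x. w x / c) \<in> L2_space \<mu>"
  using L2_space_scale[of w \<mu> "1 / c"] by simp

lemma L2_space_zero: "(\<lambda>x. 0) \<in> L2_space \<mu>"
  by (simp add: L2_space_def)

lemma L2_space_sum:
  "(\<And>i. i \<in> I \<Longrightarrow> w i \<in> L2_space \<mu>) \<Longrightarrow> (\<lambda>x. \<Sum>i\<in>I. w i x) \<in> L2_space \<mu>"
  by (induction I rule: infinite_finite_induct) (auto intro: L2_space_zero L2_space_add)

lemmas L2_space_intros = L2_space_add L2_space_diff L2_space_scale L2_space_divide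
  L2_space_zero L2_space_sum

lemma L2_inner_diff_left:
  assumes "v \<in> L2_space \<mu>" "w \<in> L2_space \<mu>" "z \<in> L2_space \<mu>"
  shows "L2_inner \<mu> (\<lambda>x. v x - w x) z = L2_inner \<mu> v z - L2_inner \<mu> w z"
  using assms by (simp add: L2_inner_def left_diff_distrib L2_space_integrable_mult)

lemma L2_inner_add_left:
  assumes "v \<in> L2_space \<mu>" "w \<in> L2_space \<mu>" "z \<in> L2_space \<mu>"
  shows "L2_inner \<mu> (\<lambda>x. v x + w x) z = L2_inner \<mu> v z + L2_inner \<mu> w z"
  using assms by (simp add: L2_inner_def distrib_right L2_space_integrable_mult)

lemma L2_inner_scale_left: "L2_inner \<mu> (\<lambda>x. c * v x) z = c * L2_inner \<mu> v z"
  by (simp add: L2_inner_def mult.assoc)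

lemma L2_inner_divide_left: "L2_inner \<mu> (\<lambda>x. v x / c) z = L2_inner \<mu> v z / c"
  using L2_inner_scale_left[of \<mu> "1 / c" v z] by simp

lemma L2_inner_sum_right:
  assumes "\<And>i. i \<in> I \<Longrightarrow> w i \<in> L2_space \<mu>" "z \<in> L2_space \<mu>"
  shows "L2_inner \<mu> z (\<lambda>x. \<Sum>i\<in>I. w i x) = (\<Sum>i\<in>I. L2_inner \<mu> z (w i))"
  unfolding L2_inner_def sum_distrib_left
  by (rule Bochner_Integration.integral_sum) (use assms in \<open>auto intro: L2_space_integrable_mult\<close>)

lemma L2_inner_diff_right:
  assumes "v \<in> L2_space \<mu>" "w \<in> L2_space \<mu>" "z \<in> L2_space \<mu>"
  shows "L2_inner \<mu> z (\<lambda>x. v x - w x) = L2_inner \<mu> z v - L2_inner \<mu> z w"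
  using L2_inner_diff_left[OF assms] by (simp add: L2_inner_commute)

lemma L2_inner_scale_right: "L2_inner \<mu> z (\<lambda>x. c * v x) = c * L2_inner \<mu> z v"
  using L2_inner_scale_left[of \<mu> c v z] by (simp add: L2_inner_commute)

text \<open>The discriminant argument for the quadratic \<open>t\<close> to
  \<open>\<parallel>v - t w\<parallel>\<^sup>2\<close>. The form is only semidefinite on functions,
  so a null vector \<open>w\<close> is treated separately.\<close>

lemma L2_Cauchy_Schwarz:
  assumes v: "v \<in> L2_space \<mu>" and w: "w \<in> L2_space \<mu>"
  shows "\<bar>L2_inner \<mu> v w\<bar> \<le> L2_norm \<mu> v * L2_norm \<mu> w"
proof -
  let ?b = "L2_inner \<mu> v w"
  have quadratic: "0 \<le> (L2_norm \<mu> v)\<^sup>2 - 2 * t * ?b + t\<^sup>2 * (L2_norm \<mu> w)\<^sup>2" for t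
  proof -
    have "(L2_norm \<mu> (\<lambda>x. v x - t * w x))\<^sup>2 =
      (L2_norm \<mu> v)\<^sup>2 - 2 * t * ?b + t\<^sup>2 * (L2_norm \<mu> w)\<^sup>2"
      unfolding L2_inner_self[symmetric] using v w
      by (simp add: L2_inner_diff_left L2_inner_diff_right L2_inner_scale_left
          L2_inner_scale_right L2_space_intros L2_inner_commute[of \<mu> w v]
          power2_eq_square algebra_simps)
    then show ?thesis
      by (metis zero_le_power2)
  qed
  have "?b\<^sup>2 \<le> (L2_norm \<mu> v)\<^sup>2 * (L2_norm \<mu> w)\<^sup>2"
  proof (cases "L2_norm \<mu> w = 0")
    case True
    show ?thesis
    proof (rule ccontr)
      assume "\<not> ?thesis"
      with True have "?b \<noteq> 0" by auto
      then show False
        \<comment> \<open>For \<open>\<parallel>w\<parallel> = 0\<close> the quadratic is affine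
          with nonzero slope; this \<open>t\<close> gives it the value
          \<open>- \<parallel>v\<parallel>\<^sup>2 - 2\<close>, a contradiction.\<close>
        using quadratic[of "((L2_norm \<mu> v)\<^sup>2 + 1) / ?b"] True zero_le_power2[of "L2_norm \<mu> v"]
        by (auto simp: not_le) 
    qed
  next
    case False
    then have "0 < L2_norm \<mu> w * L2_norm \<mu> w"
      by (simp add: zero_less_mult_iff less_le)
    with False show ?thesis
      \<comment> \<open>This is the minimizer of the quadratic.\<close>
      using quadratic[of "?b / (L2_norm \<mu> w)\<^sup>2"]
      by (simp add: field_simps power2_eq_square zero_le_divide_iff)
  qed
  then have "\<bar>?b\<bar>\<^sup>2 \<le> (L2_norm \<mu> v * L2_norm \<mu> w)\<^sup>2"
    by (simp add: power_mult_distrib)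
  then show ?thesis
    by (rule power2_le_imp_le) simp
qed

lemma L2_inner_tendsto_left:
  assumes "\<forall>\<^sub>F s in F. v s \<in> L2_space \<mu>" "l \<in> L2_space \<mu>" "z \<in> L2_space \<mu>"
    and "((\<lambda>s. L2_norm \<mu> (\<lambda>x. v s x - l x)) \<longlongrightarrow> 0) F"
  shows "((\<lambda>s. L2_inner \<mu> (v s) z) \<longlongrightarrow> L2_inner \<mu> l z) F"
proof (rule LIM_zero_cancel, rule Lim_null_comparison)
  show "((\<lambda>s. L2_norm \<mu> (\<lambda>x. v s x - l x) * L2_norm \<mu> z) \<longlongrightarrow> 0) F"
    by (rule tendsto_mult_left_zero) (rule assms(4))
  show "\<forall>\<^sub>F s in F. norm (L2_inner \<mu> (v s) z - L2_inner \<mu> l z)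
      \<le> L2_norm \<mu> (\<lambda>x. v s x - l x) * L2_norm \<mu> z"
    using assms(1)
  proof eventually_elim
    case (elim s)
    then show ?case
      using L2_Cauchy_Schwarz[OF L2_space_diff[OF elim assms(2)] assms(3)] assms(2,3)
      by (simp add: L2_inner_diff_left)
  qed
qed

lemma L2_inner_tendsto_right:
  assumes "\<forall>\<^sub>F s in F. v s \<in> L2_space \<mu>" "l \<in> L2_space \<mu>" "z \<in> L2_space \<mu>"
    and "((\<lambda>s. L2_norm \<mu> (\<lambda>x. v s x - l x)) \<longlongrightarrow> 0) F"
  shows "((\<lambda>s. L2_inner \<mu> z (v s)) \<longlongrightarrow> L2_inner \<mu> z l) F"
  using L2_inner_tendsto_left[OF assms] by (simp add: L2_inner_commute)

text \<open>Closes the norm estimates obtained by pairing a function with itself: one factor of the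
  norm is cancelled, also when it vanishes.\<close>

lemma le_of_square_le_mult:
  fixes a b :: real
  assumes "a\<^sup>2 \<le> b * a" "0 \<le> b"
  shows "a \<le> b"
  using assms by (cases "a \<le> 0") (auto simp: power2_eq_square)

lemma L2_norm_diff_le:
  assumes "v \<in> L2_space \<mu>" "w \<in> L2_space \<mu>"
  shows "L2_norm \<mu> (\<lambda>x. v x - w x) \<le> L2_norm \<mu> v + L2_norm \<mu> w"
proof (rule le_of_square_le_mult)
  let ?z = "\<lambda>x. v x - w x"
  have z: "?z \<in> L2_space \<mu>" by (intro L2_space_diff assms)
  have "(L2_norm \<mu> ?z)\<^sup>2 = L2_inner \<mu> v ?z - L2_inner \<mu> w ?z"
    unfolding L2_inner_self[symmetric] by (rule L2_inner_diff_left[OF assms z])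
  also have "\<dots> \<le> (L2_norm \<mu> v + L2_norm \<mu> w) * L2_norm \<mu> ?z"
    using L2_Cauchy_Schwarz[OF assms(1) z] L2_Cauchy_Schwarz[OF assms(2) z]
    by (simp add: distrib_right)
  finally show "(L2_norm \<mu> ?z)\<^sup>2 \<le> (L2_norm \<mu> v + L2_norm \<mu> w) * L2_norm \<mu> ?z" .
qed simp

lemma L2_norm_divide: "L2_norm \<mu> (\<lambda>x. w x / c) = L2_norm \<mu> w / \<bar>c\<bar>"
  by (simp add: L2_norm_def power_divide real_sqrt_divide)

section \<open>Calculus in time for square integrable functions, through scalar pairings\<close>

lemma L2_has_derivative_on_inner:
  assumes "L2_has_derivative_on \<mu> I v v'" "z \<in> L2_space \<mu>" "t \<in> I"
  shows "((\<lambda>s. L2_inner \<mu> (v s) z) has_real_derivative L2_inner \<mu> (v' t) z) (at t within I)"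
proof -
  have mem: "v s \<in> L2_space \<mu>" if "s \<in> I" for s
    using assms(1) that by (simp add: L2_has_derivative_on_def)
  have ev: "\<forall>\<^sub>F s in at t within I. s \<in> I"
    by (simp add: eventually_at_filter)
  have "((\<lambda>s. L2_inner \<mu> (\<lambda>x. (v s x - v t x) / (s - t)) z) \<longlongrightarrow> L2_inner \<mu> (v' t) z)
      (at t within I)"
  proof (rule L2_inner_tendsto_left)
    show "\<forall>\<^sub>F s in at t within I. (\<lambda>x. (v s x - v t x) / (s - t)) \<in> L2_space \<mu>"
      using ev by eventually_elim (intro L2_space_intros mem assms(3))
  qed (use assms in \<open>auto simp: L2_has_derivative_on_def\<close>)
  moreover have "\<forall>\<^sub>F s in at t within I. L2_inner \<mu> (\<lambda>x. (v s x - v t x) / (s - t)) z =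
      (L2_inner \<mu> (v s) z - L2_inner \<mu> (v t) z) / (s - t)"
    using ev by eventually_elim
      (simp add: L2_inner_divide_left L2_inner_diff_left mem assms(2,3))
  ultimately have "((\<lambda>s. (L2_inner \<mu> (v s) z - L2_inner \<mu> (v t) z) / (s - t)) \<longlongrightarrow>
      L2_inner \<mu> (v' t) z) (at t within I)"
    by (rule Lim_transform_eventually)
  then show ?thesis
    by (simp add: has_field_derivative_iff)
qed

lemma L2_continuous_on_inner:
  assumes "L2_continuous_on \<mu> I v" "z \<in> L2_space \<mu>"
  shows "continuous_on I (\<lambda>s. L2_inner \<mu> (v s) z)"
  unfolding continuous_on_def
proof
  fix t assume t: "t \<in> I"
  show "((\<lambda>s. L2_inner \<mu> (v s) z) \<longlongrightarrow> L2_inner \<mu> (v t) z) (at t within I)"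
  proof (rule L2_inner_tendsto_left)
    show "\<forall>\<^sub>F s in at t within I. v s \<in> L2_space \<mu>"
      using assms(1) by (auto simp: eventually_at_filter L2_continuous_on_def)
  qed (use assms t in \<open>auto simp: L2_continuous_on_def\<close>)
qed

lemma L2_has_derivative_on_inner_at:
  assumes "L2_has_derivative_on \<mu> {0<..T} v v'" "z \<in> L2_space \<mu>" "0 < t" "t < T"
  shows "((\<lambda>s. L2_inner \<mu> (v s) z) has_real_derivative L2_inner \<mu> (v' t) z) (at t)"
proof -
  have "at t within {0<..T} = at t"
    by (rule at_within_open_subset[of _ "{0<..<T}"]) (use assms in auto)
  then show ?thesis
    using L2_has_derivative_on_inner[OF assms(1,2), of t] assms by simp
qed

text \<open>A mean value identity fails for vector-valued functions, but after pairing with a fixed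
  \<open>z\<close> the scalar theorem applies; the point \<open>\<xi>\<close> depends on
  \<open>z\<close>.\<close>

lemma L2_inner_mean_value:
  assumes deriv: "L2_has_derivative_on \<mu> {0<..T} v v'" and z: "z \<in> L2_space \<mu>"
    and ab: "0 < a" "a < b" "b \<le> T"
  obtains \<xi> where "a < \<xi>" "\<xi> < b"
    "L2_inner \<mu> (v b) z - L2_inner \<mu> (v a) z = (b - a) * L2_inner \<mu> (v' \<xi>) z"
proof -
  have at: "((\<lambda>s. L2_inner \<mu> (v s) z) has_real_derivative L2_inner \<mu> (v' t) z) (at t)"
    if "a < t" "t < b" for t
    using that ab by (intro L2_has_derivative_on_inner_at[OF deriv z]) auto
  have "continuous_on {0<..T} (\<lambda>s. L2_inner \<mu> (v s) z)"
    by (rule DERIV_continuous_on) (rule L2_has_derivative_on_inner[OF deriv z])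
  then have cont: "continuous_on {a..b} (\<lambda>s. L2_inner \<mu> (v s) z)"
    by (rule continuous_on_subset) (use ab in auto)
  obtain l \<xi> where \<xi>: "a < \<xi>" "\<xi> < b"
    "((\<lambda>s. L2_inner \<mu> (v s) z) has_real_derivative l) (at \<xi>)"
    "L2_inner \<mu> (v b) z - L2_inner \<mu> (v a) z = (b - a) * l"
    using MVT[OF ab(2) cont] at by (auto simp: real_differentiable_def)
  moreover have "l = L2_inner \<mu> (v' \<xi>) z"
    using DERIV_unique[OF \<xi>(3) at[OF \<xi>(1,2)]] .
  ultimately show ?thesis using that by blast
qed

text \<open>The remainder \<open>?R\<close> is paired with itself. The mean value identity replaces
  the difference quotient by \<open>v'\<close> at some \<open>\<xi>\<close>, and a second use
  compares \<open>v' \<xi>\<close> with \<open>v' b\<close>.\<close>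

lemma L2_backward_difference_remainder:
  assumes d1: "L2_has_derivative_on \<mu> {0<..T} v v'" and d2: "L2_has_derivative_on \<mu> {0<..T} v' v''"
    and ab: "0 < a" "a < b" "b \<le> T"
    and bound: "\<And>s. a \<le> s \<Longrightarrow> s \<le> b \<Longrightarrow> L2_norm \<mu> (v'' s) \<le> B"
  shows "L2_norm \<mu> (\<lambda>x. (v b x - v a x) / (b - a) - v' b x) \<le> (b - a) * B"
proof (rule le_of_square_le_mult)
  let ?R = "\<lambda>x. (v b x - v a x) / (b - a) - v' b x"
  have L2: "v s \<in> L2_space \<mu>" "v' s \<in> L2_space \<mu>" "v'' s \<in> L2_space \<mu>" if "0 < s" "s \<le> T" for s
    using d1 d2 that by (auto simp: L2_has_derivative_on_def)
  have mem: "v a \<in> L2_space \<mu>" "v b \<in> L2_space \<mu>" "v' b \<in> L2_space \<mu>"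
    using ab by (auto intro: L2)
  have R: "?R \<in> L2_space \<mu>"
    by (intro L2_space_intros mem)
  obtain \<xi> where \<xi>: "a < \<xi>" "\<xi> < b"
    "L2_inner \<mu> (v b) ?R - L2_inner \<mu> (v a) ?R = (b - a) * L2_inner \<mu> (v' \<xi>) ?R"
    by (rule L2_inner_mean_value[OF d1 R ab])
  obtain \<eta> where \<eta>: "\<xi> < \<eta>" "\<eta> < b"
    "L2_inner \<mu> (v' b) ?R - L2_inner \<mu> (v' \<xi>) ?R = (b - \<xi>) * L2_inner \<mu> (v'' \<eta>) ?R"
    by (rule L2_inner_mean_value[OF d2 R]) (use ab \<xi> in auto)
  \<comment> \<open>The sign of \<open>B\<close> is read off from its bound at the endpoint
    \<open>b\<close>.\<close>
  have "0 \<le> L2_norm \<mu> (v'' b)" by simp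
  also have "\<dots> \<le> B" using ab by (intro bound) auto
  finally have B: "0 \<le> B" .
  then show "0 \<le> (b - a) * B" using ab by simp
  have "(L2_norm \<mu> ?R)\<^sup>2 = L2_inner \<mu> ?R ?R"
    by (rule L2_inner_self[symmetric])
  also have "\<dots> = (L2_inner \<mu> (v b) ?R - L2_inner \<mu> (v a) ?R) / (b - a) - L2_inner \<mu> (v' b) ?R"
    by (simp add: L2_inner_diff_left[OF _ _ R] L2_inner_divide_left mem L2_space_intros)
  also have "\<dots> = L2_inner \<mu> (v' \<xi>) ?R - L2_inner \<mu> (v' b) ?R"
    using \<xi>(3) ab by simp
  also have "\<dots> = - (b - \<xi>) * L2_inner \<mu> (v'' \<eta>) ?R"
    using \<eta>(3) by (simp only: mult_minus_left)
  also have "\<dots> \<le> (b - \<xi>) * \<bar>L2_inner \<mu> (v'' \<eta>) ?R\<bar>"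
    using mult_left_mono[OF abs_ge_minus_self, of "b - \<xi>" "L2_inner \<mu> (v'' \<eta>) ?R"] \<xi>(2)
    by (simp only: mult_minus_left mult_minus_right)
  also have "\<dots> \<le> (b - a) * (B * L2_norm \<mu> ?R)"
  proof (rule mult_mono)
    have "\<bar>L2_inner \<mu> (v'' \<eta>) ?R\<bar> \<le> L2_norm \<mu> (v'' \<eta>) * L2_norm \<mu> ?R"
      by (rule L2_Cauchy_Schwarz[OF L2(3) R]) (use \<xi> \<eta> ab in auto)
    also have "\<dots> \<le> B * L2_norm \<mu> ?R"
      using \<xi> \<eta> by (intro mult_right_mono bound) auto
    finally show "\<bar>L2_inner \<mu> (v'' \<eta>) ?R\<bar> \<le> B * L2_norm \<mu> ?R" .
  qed (use \<xi> ab in auto)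
  finally show "(L2_norm \<mu> ?R)\<^sup>2 \<le> (b - a) * B * L2_norm \<mu> ?R"
    by (simp add: mult.assoc)
qed

text \<open>The bound on \<open>v'\<close> may be singular at 0, so the pairing of \<open>v\<close>
  with the increment \<open>?z\<close> is compared with a primitive of the bound. Continuity at 0
  and derivatives at positive times suffice for monotonicity.\<close>

lemma L2_norm_increment_from_zero:
  assumes cont: "L2_continuous_on \<mu> {0..T} v" and deriv: "L2_has_derivative_on \<mu> {0<..T} v v'"
    and \<alpha>: "0 < \<alpha>" and b: "0 < b" "b \<le> T" and M: "0 \<le> M"
    and bound: "\<And>s. 0 < s \<Longrightarrow> s \<le> b \<Longrightarrow> L2_norm \<mu> (v' s) \<le> M * s powr (\<alpha> - 1)"
  shows "L2_norm \<mu> (\<lambda>x. v b x - v 0 x) \<le> M / \<alpha> * b powr \<alpha>"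
proof (rule le_of_square_le_mult)
  let ?z = "\<lambda>x. v b x - v 0 x"
  have L2: "v b \<in> L2_space \<mu>" "v 0 \<in> L2_space \<mu>"
    using cont b by (auto simp: L2_continuous_on_def)
  then have z: "?z \<in> L2_space \<mu>"
    by (rule L2_space_diff)
  define m where "m = M * L2_norm \<mu> ?z"
  let ?g = "\<lambda>s. m / \<alpha> * s powr \<alpha> - L2_inner \<mu> (v s) ?z"
  \<comment> \<open>Since \<open>0 powr \<alpha>\<close> is 0, this bounds the increment of the
    pairing by \<open>m / \<alpha> * b powr \<alpha>\<close>.\<close>
  have "?g 0 \<le> ?g b"
  proof (rule DERIV_nonneg_imp_increasing_open[where f = ?g])
    have "continuous_on {0..b} (\<lambda>s. L2_inner \<mu> (v s) ?z)"
      using L2_continuous_on_inner[OF cont z] by (rule continuous_on_subset) (use b in auto)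
    then show "continuous_on {0..b} ?g"
      using \<alpha> by (intro continuous_intros continuous_on_powr') auto
    fix s assume s: "0 < s" "s < b"
    have "(?g has_real_derivative m / \<alpha> * (\<alpha> * s powr (\<alpha> - 1)) - L2_inner \<mu> (v' s) ?z) (at s)"
      using s b by (intro DERIV_diff DERIV_cmult has_real_derivative_powr
          L2_has_derivative_on_inner_at[OF deriv z]) auto
    moreover have "L2_inner \<mu> (v' s) ?z \<le> m * s powr (\<alpha> - 1)"
    proof -
      have "v' s \<in> L2_space \<mu>"
        using deriv s b by (simp add: L2_has_derivative_on_def)
      then have "L2_inner \<mu> (v' s) ?z \<le> L2_norm \<mu> (v' s) * L2_norm \<mu> ?z"
        using L2_Cauchy_Schwarz[OF _ z, of "v' s"] by simp
      also have "\<dots> \<le> M * s powr (\<alpha> - 1) * L2_norm \<mu> ?z"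
        using s by (intro mult_right_mono bound) auto
      finally show ?thesis by (simp add: m_def mult_ac)
    qed
    ultimately show "\<exists>y. (?g has_real_derivative y) (at s) \<and> 0 \<le> y"
      using \<alpha> by (intro exI conjI) auto
  qed (use b in simp)
  moreover have "(L2_norm \<mu> ?z)\<^sup>2 = L2_inner \<mu> (v b) ?z - L2_inner \<mu> (v 0) ?z"
    unfolding L2_inner_self[symmetric] by (rule L2_inner_diff_left[OF L2 z])
  ultimately show "(L2_norm \<mu> ?z)\<^sup>2 \<le> M / \<alpha> * b powr \<alpha> * L2_norm \<mu> ?z"
    using \<alpha> by (simp add: m_def mult_ac)
  show "0 \<le> M / \<alpha> * b powr \<alpha>"
    using \<alpha> M by simp
qed

section \<open>The Dirichlet Laplacian\<close>

text \<open>On the partial Fourier sums of \<open>w\<close> the inequality holds term by term, since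
  each term is a squared coefficient times an eigenvalue. Both pairings pass to the limit by
  Cauchy-Schwarz.\<close>

lemma L2_coercive_of_eigenbasis:
  assumes basis: "L2_orthonormal_basis \<mu> \<omega>"
    and w: "w \<in> L2_space \<mu>" and g: "g \<in> L2_space \<mu>"
    and eig: "\<And>j. L2_inner \<mu> g (\<omega> j) = - lam j * L2_inner \<mu> w (\<omega> j)"
    and lower: "\<And>j. l \<le> lam j"
  shows "L2_inner \<mu> g w \<le> - l * (L2_norm \<mu> w)\<^sup>2"
proof -
  let ?S = "\<lambda>m x. \<Sum>j<m. L2_inner \<mu> w (\<omega> j) * \<omega> j x"
  have \<omega>: "\<omega> j \<in> L2_space \<mu>" for j
    using basis by (simp add: L2_orthonormal_basis_def)
  have S: "?S m \<in> L2_space \<mu>" for m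
    by (intro L2_space_intros \<omega>)
  have inner_S: "L2_inner \<mu> z (?S m) = (\<Sum>j<m. L2_inner \<mu> w (\<omega> j) * L2_inner \<mu> z (\<omega> j))"
    if "z \<in> L2_space \<mu>" for z m
    by (subst L2_inner_sum_right) (auto intro!: L2_space_scale \<omega> that simp: L2_inner_scale_right)
  have "(\<lambda>m. L2_norm \<mu> (\<lambda>x. w x - ?S m x)) \<longlonglongrightarrow> 0"
    using basis w by (simp add: L2_orthonormal_basis_def)
  then have "(\<lambda>m. L2_norm \<mu> (\<lambda>x. ?S m x - w x)) \<longlonglongrightarrow> 0"
    by (simp add: L2_norm_def power2_commute)
  then have lim: "(\<lambda>m. L2_inner \<mu> z (?S m)) \<longlonglongrightarrow> L2_inner \<mu> z w" if "z \<in> L2_space \<mu>" for z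
    by (intro L2_inner_tendsto_right w that always_eventually allI S)
  have "L2_inner \<mu> g w \<le> - l * L2_inner \<mu> w w"
  proof (rule LIMSEQ_le[OF lim[OF g] tendsto_mult_left[OF lim[OF w]]], intro exI allI impI)
    fix m :: nat
    show "L2_inner \<mu> g (?S m) \<le> - l * L2_inner \<mu> w (?S m)"
      unfolding inner_S[OF g] inner_S[OF w] sum_distrib_left
    proof (rule sum_mono)
      fix j
      have "l * (L2_inner \<mu> w (\<omega> j))\<^sup>2 \<le> lam j * (L2_inner \<mu> w (\<omega> j))\<^sup>2"
        by (rule mult_right_mono[OF lower]) simp
      then show "L2_inner \<mu> w (\<omega> j) * L2_inner \<mu> g (\<omega> j)
          \<le> - l * (L2_inner \<mu> w (\<omega> j) * L2_inner \<mu> w (\<omega> j))"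
        by (simp add: eig power2_eq_square algebra_simps)
    qed
  qed
  then show ?thesis
    by (simp add: L2_inner_self)
qed

section \<open>Measurability and finite measure on bounded domains\<close>

abbreviation euclidean_lborel :: "nat \<Rightarrow> (nat \<Rightarrow> real) measure" where
  "euclidean_lborel d \<equiv> \<Pi>\<^sub>M i\<in>{..<d}. lborel"

lemma space_euclidean_lborel: "space (euclidean_lborel d) = topspace (euclidean_top d)"
  by (simp add: space_PiM PiE_def)

lemma measurable_euclidean_lborel_borel:
  "(\<lambda>x. x) \<in> measurable (euclidean_lborel d) (borel :: (nat \<Rightarrow> real) measure)"
proof (rule measurable_coordinatewise_then_product)
  fix i
  show "(\<lambda>x. x i) \<in> borel_measurable (euclidean_lborel d)"
  proof (cases "i < d")
    \<comment> \<open>On the space of the product measure, coordinates beyond the dimension are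
      constantly \<open>undefined\<close>.\<close>
    case False
    then have "(\<lambda>x. x i) \<in> borel_measurable (euclidean_lborel d) \<longleftrightarrow>
        (\<lambda>x. undefined :: real) \<in> borel_measurable (euclidean_lborel d)"
      by (intro measurable_cong) (auto simp: space_PiM PiE_def extensional_def)
    then show ?thesis by simp
  qed (use measurable_component_singleton[of i "{..<d}" "\<lambda>_. lborel"] in simp)
qed

text \<open>Restriction retracts the type of all functions onto the carrier of
  \<open>euclidean_top d\<close>. Composing with it transfers continuity and openness to the
  topology of the type, whose Borel sets are at hand.\<close>

lemma continuous_map_restrict_euclidean:
  "continuous_map (euclidean :: (nat \<Rightarrow> real) topology) (euclidean_top d) (\<lambda>x. restrict x {..<d})"
  unfolding continuous_map_componentwise
proof (intro conjI ballI)
  fix k assume "k \<in> {..<d}"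
  then show "continuous_map euclidean euclideanreal (\<lambda>x :: nat \<Rightarrow> real. restrict x {..<d} k)"
    using continuous_on_product_coordinates[of k] by simp
qed auto

lemma restrict_topspace_euclidean_top:
  "x \<in> topspace (euclidean_top d) \<Longrightarrow> restrict x {..<d} = x"
  by (simp add: PiE_iff extensional_restrict)

lemma continuous_map_borel_measurable:
  assumes "continuous_map (euclidean_top d) euclideanreal \<phi>"
  shows "\<phi> \<in> borel_measurable (euclidean_lborel d)"
proof -
  have "continuous_on UNIV (\<phi> \<circ> (\<lambda>x. restrict x {..<d}))"
    using continuous_map_compose[OF continuous_map_restrict_euclidean assms] by simp
  then have "\<phi> \<circ> (\<lambda>x. restrict x {..<d}) \<in> borel_measurable borel"
    by (rule borel_measurable_continuous_onI)
  from measurable_compose[OF measurable_euclidean_lborel_borel this]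
  have "(\<lambda>x. \<phi> (restrict x {..<d})) \<in> borel_measurable (euclidean_lborel d)"
    by (simp only: o_def)
  moreover have "\<phi> (restrict x {..<d}) = \<phi> x" if "x \<in> space (euclidean_lborel d)" for x
    using restrict_topspace_euclidean_top[of x d] that by (simp only: space_euclidean_lborel)
  ultimately show ?thesis
    by (simp only: measurable_cong[of "euclidean_lborel d" "\<lambda>x. \<phi> (restrict x {..<d})" \<phi>])
qed

text \<open>The preimage of \<open>S\<close> under restriction is open in the full function space,
  hence Borel, and meets the carrier exactly in \<open>S\<close>.\<close>

lemma openin_sets_euclidean_lborel:
  assumes "openin (euclidean_top d) S"
  shows "S \<in> sets (euclidean_lborel d)"
proof -
  let ?T = "{x. restrict x {..<d} \<in> S}"
  have "open ?T"
    using openin_continuous_map_preimage[OF continuous_map_restrict_euclidean assms]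
    by simp
  then have "?T \<in> sets borel"
    by (rule borel_open)
  then have "(\<lambda>x. x) -` ?T \<inter> space (euclidean_lborel d) \<in> sets (euclidean_lborel d)"
    by (rule measurable_sets[OF measurable_euclidean_lborel_borel])
  also have "(\<lambda>x. x) -` ?T \<inter> space (euclidean_lborel d) = {x \<in> topspace (euclidean_top d). x \<in> S}"
    unfolding space_euclidean_lborel using restrict_topspace_euclidean_top by fastforce
  also have "\<dots> = S"
    using openin_subset[OF assms] by blast
  finally show ?thesis .
qed

lemma bounded_domain_subset_box:
  assumes "bounded_domain d \<Omega>"
  obtains r where "\<Omega> \<subseteq> (\<Pi>\<^sub>E i\<in>{..<d}. {-r..r})"
proof -
  obtain r where r: "\<And>x i. x \<in> \<Omega> \<Longrightarrow> i < d \<Longrightarrow> \<bar>x i\<bar> \<le> r"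
    using assms by (auto simp: bounded_domain_def)
  have "\<Omega> \<subseteq> topspace (euclidean_top d)"
    using assms by (intro openin_subset) (simp only: bounded_domain_def)
  then have "\<Omega> \<subseteq> (\<Pi>\<^sub>E i\<in>{..<d}. {-r..r})"
    using r by (auto simp: PiE_iff extensional_def abs_le_iff minus_le_iff subset_iff)
  then show ?thesis ..
qed

lemma bounded_domain_sets:
  assumes "bounded_domain d \<Omega>"
  shows "\<Omega> \<in> sets (euclidean_lborel d)" "\<Omega> \<in> sets (completion (euclidean_lborel d))"
proof -
  show "\<Omega> \<in> sets (euclidean_lborel d)"
    using assms by (intro openin_sets_euclidean_lborel) (simp only: bounded_domain_def)
  then show "\<Omega> \<in> sets (completion (euclidean_lborel d))"
    by (rule sets_completionI_sets)
qed

lemma space_lebesgue_dom: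
  assumes "bounded_domain d \<Omega>"
  shows "space (lebesgue_dom d \<Omega>) = \<Omega>"
  using sets.sets_into_space[OF bounded_domain_sets(2)[OF assms]]
  unfolding lebesgue_dom_def space_restrict_space by (rule Int_absorb2)

lemma finite_measure_lebesgue_dom:
  assumes "bounded_domain d \<Omega>"
  shows "finite_measure (lebesgue_dom d \<Omega>)"
proof (rule finite_measureI)
  interpret product_sigma_finite "\<lambda>_::nat. lborel :: real measure" ..
  obtain r where r: "\<Omega> \<subseteq> (\<Pi>\<^sub>E i\<in>{..<d}. {-r..r})"
    using bounded_domain_subset_box[OF assms] .
  note \<Omega> = bounded_domain_sets[OF assms]
  have "emeasure (lebesgue_dom d \<Omega>) (space (lebesgue_dom d \<Omega>)) = emeasure (euclidean_lborel d) \<Omega>"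
    using \<Omega> sets.sets_into_space[OF \<Omega>(1)]
    unfolding space_lebesgue_dom[OF assms]
    by (simp add: lebesgue_dom_def emeasure_restrict_space)
  also have "\<dots> \<le> emeasure (euclidean_lborel d) (\<Pi>\<^sub>E i\<in>{..<d}. {-r..r})"
    by (intro emeasure_mono r sets_PiM_I_finite) auto
  also have "\<dots> = (\<Prod>i<d. emeasure lborel {-r..r})"
    by (rule emeasure_PiM) auto
  also have "\<dots> < \<infinity>"
    by (simp add: ennreal_prod_eq_top less_top[symmetric] emeasure_lborel_Icc_eq del: prod_constant)
  finally show "emeasure (lebesgue_dom d \<Omega>) (space (lebesgue_dom d \<Omega>)) \<noteq> \<infinity>"
    by simp
qed

text \<open>A function continuous on the whole space is bounded on a compact box containing
  \<open>\<Omega>\<close>, and \<open>\<Omega>\<close> has finite measure.\<close>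

lemma continuous_map_L2_space:
  assumes \<Omega>: "bounded_domain d \<Omega>" and \<phi>: "continuous_map (euclidean_top d) euclideanreal \<phi>"
  shows "\<phi> \<in> L2_space (lebesgue_dom d \<Omega>)"
proof -
  interpret finite_measure "lebesgue_dom d \<Omega>"
    by (rule finite_measure_lebesgue_dom[OF \<Omega>])
  have meas: "\<phi> \<in> borel_measurable (lebesgue_dom d \<Omega>)"
    unfolding lebesgue_dom_def
    by (intro measurable_restrict_space1 measurable_completion continuous_map_borel_measurable \<phi>)
  obtain r where r: "\<Omega> \<subseteq> (\<Pi>\<^sub>E i\<in>{..<d}. {-r..r})"
    using bounded_domain_subset_box[OF \<Omega>] .
  have "compactin (euclidean_top d) (\<Pi>\<^sub>E i\<in>{..<d}. {-r..r})"
    by (simp add: compactin_PiE)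
  then have "compactin euclideanreal (\<phi> ` (\<Pi>\<^sub>E i\<in>{..<d}. {-r..r}))"
    using \<phi> by (rule image_compactin)
  then have "bounded (\<phi> ` (\<Pi>\<^sub>E i\<in>{..<d}. {-r..r}))"
    by (simp add: compact_imp_bounded)
  then obtain B where B: "\<And>x. x \<in> (\<Pi>\<^sub>E i\<in>{..<d}. {-r..r}) \<Longrightarrow> \<bar>\<phi> x\<bar> \<le> B"
    by (auto simp: bounded_iff)
  have "integrable (lebesgue_dom d \<Omega>) (\<lambda>x. (\<phi> x)\<^sup>2)"
  proof (rule integrable_const_bound)
    show "AE x in lebesgue_dom d \<Omega>. norm ((\<phi> x)\<^sup>2) \<le> B\<^sup>2"
    proof (rule AE_I2)
      fix x assume "x \<in> space (lebesgue_dom d \<Omega>)"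
      then have "\<bar>\<phi> x\<bar> \<le> B"
        using B r by (auto simp only: space_lebesgue_dom[OF \<Omega>])
      then show "norm ((\<phi> x)\<^sup>2) \<le> B\<^sup>2"
        using power_mono[of "\<bar>\<phi> x\<bar>" B 2] by simp
    qed
  qed (use meas in measurable)
  with meas show ?thesis
    by (simp add: L2_space_def)
qed

section \<open>The weak formulation, symmetry and coercivity\<close>

lemma test_function_L2:
  assumes "bounded_domain d \<Omega>" "test_function d \<Omega> \<phi>"
  shows "\<phi> \<in> L2_space (lebesgue_dom d \<Omega>)"
    and "i < d \<Longrightarrow> partial i \<phi> \<in> L2_space (lebesgue_dom d \<Omega>)"
proof -
  have "cont_diff d 1 \<phi>"
    using assms(2) unfolding test_function_def by blast
  then show "\<phi> \<in> L2_space (lebesgue_dom d \<Omega>)"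
    and "i < d \<Longrightarrow> partial i \<phi> \<in> L2_space (lebesgue_dom d \<Omega>)"
    using continuous_map_L2_space[OF assms(1)] by auto
qed

lemma dirichlet_laplacian_L2:
  assumes "dirichlet_laplacian d \<Omega> w g"
  shows "w \<in> L2_space (lebesgue_dom d \<Omega>)" "g \<in> L2_space (lebesgue_dom d \<Omega>)"
  using assms by (auto simp: dirichlet_laplacian_def H10_gradient_def)

text \<open>By density, functions from \<open>H\<^sup>1\<^sub>0\<close> are admissible in the weak formulation.\<close>

lemma weak_laplacian_H10:
  assumes \<Omega>: "bounded_domain d \<Omega>"
    and g: "g \<in> L2_space (lebesgue_dom d \<Omega>)"
    and G: "\<And>i. i < d \<Longrightarrow> G i \<in> L2_space (lebesgue_dom d \<Omega>)"
    and weak: "\<And>\<phi>. test_function d \<Omega> \<phi> \<Longrightarrow>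
      (\<Sum>i<d. L2_inner (lebesgue_dom d \<Omega>) (G i) (partial i \<phi>)) = - L2_inner (lebesgue_dom d \<Omega>) g \<phi>"
    and v: "H10_gradient d \<Omega> v H"
  shows "(\<Sum>i<d. L2_inner (lebesgue_dom d \<Omega>) (G i) (H i)) = - L2_inner (lebesgue_dom d \<Omega>) g v"
proof -
  let ?\<mu> = "lebesgue_dom d \<Omega>"
  obtain \<psi> where \<psi>: "\<And>m. test_function d \<Omega> (\<psi> m)"
    and lim: "(\<lambda>m. L2_norm ?\<mu> (\<lambda>x. \<psi> m x - v x)) \<longlonglongrightarrow> 0"
    and lim_partial: "\<And>i. i < d \<Longrightarrow> (\<lambda>m. L2_norm ?\<mu> (\<lambda>x. partial i (\<psi> m) x - H i x)) \<longlonglongrightarrow> 0"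
    using v by (auto simp: H10_gradient_def)
  have "(\<lambda>m. \<Sum>i<d. L2_inner ?\<mu> (G i) (partial i (\<psi> m))) \<longlonglongrightarrow> (\<Sum>i<d. L2_inner ?\<mu> (G i) (H i))"
    using v by (intro tendsto_sum L2_inner_tendsto_right G lim_partial always_eventually allI
        test_function_L2[OF \<Omega> \<psi>]) (auto simp: H10_gradient_def)
  moreover have "(\<lambda>m. - L2_inner ?\<mu> g (\<psi> m)) \<longlonglongrightarrow> - L2_inner ?\<mu> g v"
    using v by (intro tendsto_minus L2_inner_tendsto_right g lim always_eventually allI
        test_function_L2[OF \<Omega> \<psi>]) (auto simp: H10_gradient_def)
  ultimately show ?thesis
    unfolding weak[OF \<psi>] by (rule LIMSEQ_unique)
qed

text \<open>Testing each weak equation with the other function shows that both sides equal minus the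
  same Dirichlet form, the sum of the pairings of \<open>G i\<close> with
  \<open>H i\<close>.\<close>

lemma dirichlet_laplacian_symmetric:
  assumes \<Omega>: "bounded_domain d \<Omega>"
    and w: "dirichlet_laplacian d \<Omega> w g" and v: "dirichlet_laplacian d \<Omega> v h"
  shows "L2_inner (lebesgue_dom d \<Omega>) g v = L2_inner (lebesgue_dom d \<Omega>) h w"
proof -
  let ?\<mu> = "lebesgue_dom d \<Omega>"
  obtain G where G: "H10_gradient d \<Omega> w G" "\<And>\<phi>. test_function d \<Omega> \<phi> \<Longrightarrow>
      (\<Sum>i<d. L2_inner ?\<mu> (G i) (partial i \<phi>)) = - L2_inner ?\<mu> g \<phi>"
    using w by (auto simp: dirichlet_laplacian_def)
  obtain H where H: "H10_gradient d \<Omega> v H" "\<And>\<phi>. test_function d \<Omega> \<phi> \<Longrightarrow>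
      (\<Sum>i<d. L2_inner ?\<mu> (H i) (partial i \<phi>)) = - L2_inner ?\<mu> h \<phi>"
    using v by (auto simp: dirichlet_laplacian_def)
  have "(\<Sum>i<d. L2_inner ?\<mu> (G i) (H i)) = - L2_inner ?\<mu> g v"
    by (rule weak_laplacian_H10[OF \<Omega> _ _ G(2) H(1)])
      (use G(1) dirichlet_laplacian_L2[OF w] in \<open>auto simp: H10_gradient_def\<close>)
  moreover have "(\<Sum>i<d. L2_inner ?\<mu> (H i) (G i)) = - L2_inner ?\<mu> h w"
    by (rule weak_laplacian_H10[OF \<Omega> _ _ H(2) G(1)])
      (use H(1) dirichlet_laplacian_L2[OF v] in \<open>auto simp: H10_gradient_def\<close>)
  ultimately show ?thesis
    by (simp add: L2_inner_commute)
qed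

text \<open>Stated for a difference of two functions in the domain, because only Fourier coefficients are
  subtracted; no linearity of the domain has to be established.\<close>

lemma dirichlet_laplacian_coercive:
  assumes \<Omega>: "bounded_domain d \<Omega>" and basis: "dirichlet_eigenbasis d \<Omega> lam \<omega>"
    and min: "minimal_dirichlet_eigenvalue d \<Omega> l"
    and w: "dirichlet_laplacian d \<Omega> w g" and v: "dirichlet_laplacian d \<Omega> v h"
  shows "L2_inner (lebesgue_dom d \<Omega>) (\<lambda>x. g x - h x) (\<lambda>x. w x - v x)
    \<le> - l * (L2_norm (lebesgue_dom d \<Omega>) (\<lambda>x. w x - v x))\<^sup>2"
proof (rule L2_coercive_of_eigenbasis)
  let ?\<mu> = "lebesgue_dom d \<Omega>"
  note L2 = dirichlet_laplacian_L2[OF w] dirichlet_laplacian_L2[OF v]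
  have eig: "dirichlet_eigenpair d \<Omega> (lam j) (\<omega> j)" for j
    using basis by (simp add: dirichlet_eigenbasis_def)
  then have lap: "dirichlet_laplacian d \<Omega> (\<omega> j) (\<lambda>x. - lam j * \<omega> j x)" for j
    by (simp only: dirichlet_eigenpair_def)
  show "L2_orthonormal_basis ?\<mu> \<omega>"
    using basis by (simp add: dirichlet_eigenbasis_def)
  show "l \<le> lam j" for j
    using min eig[of j] by (auto simp: minimal_dirichlet_eigenvalue_def)
  \<comment> \<open>Symmetry moves the Laplacian onto the eigenfunction, so it acts diagonally on
    Fourier coefficients.\<close>
  have coeff: "L2_inner ?\<mu> g' (\<omega> j) = - lam j * L2_inner ?\<mu> w' (\<omega> j)"
    if "dirichlet_laplacian d \<Omega> w' g'" for w' g' j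
    using dirichlet_laplacian_symmetric[OF \<Omega> that lap[of j]]
    by (simp only: L2_inner_scale_left L2_inner_commute)
  show "L2_inner ?\<mu> (\<lambda>x. g x - h x) (\<omega> j) = - lam j * L2_inner ?\<mu> (\<lambda>x. w x - v x) (\<omega> j)" for j
    by (simp add: L2_inner_diff_left L2 dirichlet_laplacian_L2[OF lap] coeff[OF w] coeff[OF v]
        algebra_simps)
qed (intro L2_space_diff dirichlet_laplacian_L2[OF w] dirichlet_laplacian_L2[OF v])+

section \<open>Weighted geometric sums\<close>

text \<open>Equivalent to \<open>exp (x / 2) \<le> 1 + x\<close>. Applied with
  \<open>x = \<tau> * \<delta>\<close>, where the step size restriction ensures
  \<open>x \<le> 1\<close>; it turns the damping of the scheme into exponential decay.\<close>

lemma inverse_1plus_le_exp: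
  fixes x :: real
  assumes "0 \<le> x" "x \<le> 1"
  shows "1 / (1 + x) \<le> exp (- x / 2)"
proof -
  have "exp (x / 2) \<le> 1 + x / 2 + (x / 2)\<^sup>2"
    using assms by (intro exp_bound) auto
  also have "\<dots> \<le> 1 + x"
  proof -
    have "x * x \<le> x * 1" using assms by (intro mult_left_mono) auto
    then show ?thesis using assms by (simp add: power2_eq_square)
  qed
  finally have "inverse (1 + x) \<le> inverse (exp (x / 2))"
    by (intro le_imp_inverse_le) auto
  then show ?thesis
    using exp_minus[of "x / 2"] by (simp add: inverse_eq_divide)
qed

text \<open>Unrolling the recursion: the source \<open>b i\<close> enters in step
  \<open>i + 1\<close> and is already damped there, hence the exponent \<open>n - i\<close>.\<close>

lemma linear_recursion_bound:
  fixes A b :: "nat \<Rightarrow> real"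
  assumes "0 \<le> q" "A 0 \<le> 0" "\<And>i. i < n \<Longrightarrow> A (Suc i) \<le> q * (A i + b i)"
  shows "A n \<le> (\<Sum>i<n. q ^ (n - i) * b i)"
  using assms(3)
proof (induction n)
  case 0
  then show ?case using assms(2) by simp
next
  case (Suc n)
  have "A (Suc n) \<le> q * (A n + b n)"
    by (rule Suc.prems) simp
  also have "\<dots> \<le> q * ((\<Sum>i<n. q ^ (n - i) * b i) + b n)"
    using assms(1) Suc by (intro mult_left_mono add_right_mono Suc.IH) auto
  also have "\<dots> = (\<Sum>i<Suc n. q ^ (Suc n - i) * b i)"
    by (simp add: sum_distrib_left distrib_left Suc_diff_le mult.assoc)
  finally show ?case .
qed

text \<open>The sum is split at \<open>i = n / 2\<close>: for smaller \<open>i\<close> the power of \<open>q\<close> is exponentially small, and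
  for larger \<open>i\<close> the weight \<open>i powr (\<alpha> - 2)\<close> is small.\<close>

lemma geometric_weighted_powr_sum_le:
  fixes b :: "nat \<Rightarrow> real"
  assumes \<alpha>: "\<alpha> < 1" and x: "0 \<le> x" and q: "0 \<le> q" "q \<le> exp (- x / 2)" and n: "2 \<le> n"
    and b: "\<And>i. 0 \<le> b i" "\<And>i. 1 \<le> i \<Longrightarrow> b i = real i powr (\<alpha> - 2)" and b_sum: "summable b"
  shows "(\<Sum>i<n. q ^ (n - i) * b i)
    \<le> suminf b * exp (- (x * real n) / 4) + 2 powr (2 - \<alpha>) * real (n - 1) powr (\<alpha> - 1)"
proof -
  let ?E = "exp (- (x * real n) / 4)"
  \<comment> \<open>Bounds every weight with \<open>i > n / 2\<close>. Using \<open>n - 1\<close>,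
    positive as \<open>n \<ge> 2\<close>, makes the tail a power of \<open>n - 1\<close>, matching
    \<open>t_{n-1}\<close> in the final estimate.\<close>
  let ?y = "(real (n - 1) / 2) powr (\<alpha> - 2)"
  have q1: "q \<le> 1"
    using q(2) x by (auto intro: order_trans)
  \<comment> \<open>Each index needs only one of the two summands, and both are nonnegative. Index 0
    always falls into the first case, so it gets no share of the tail.\<close>
  have split: "q ^ (n - i) * b i \<le> ?E * b i + (if i = 0 then 0 else ?y)" if i: "i < n" for i
  proof (cases "2 * i \<le> n")
    case True
    have "q ^ (n - i) \<le> exp (- x / 2) ^ (n - i)"
      using q by (intro power_mono) auto
    also have "\<dots> = exp (- (x * (2 * real (n - i)) / 4))"
      by (simp add: exp_of_nat_mult[symmetric] algebra_simps)
    also have "\<dots> \<le> ?E"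
    proof -
      have "x * real n \<le> x * (2 * real (n - i))"
        using True x by (intro mult_left_mono) (auto simp: of_nat_diff)
      then show ?thesis by simp
    qed
    finally have "q ^ (n - i) * b i \<le> ?E * b i"
      by (rule mult_right_mono) (rule b)
    then show ?thesis by (simp add: add_increasing2)
  next
    case False
    then have i1: "1 \<le> i" by simp
    have "q ^ (n - i) * b i \<le> 1 * b i"
      using q q1 by (intro mult_right_mono b power_le_one) auto
    also have "\<dots> \<le> ?y"
      using False n \<alpha> i1 by (simp add: b(2)) (intro powr_mono2', auto simp: of_nat_diff)
    finally show ?thesis
      using i1 b(1)[of i] by (simp add: add_increasing)
  qed
  have "(\<Sum>i<n. if i = 0 then 0 else ?y) = real (n - 1) * ?y"
  proof -
    have "{..<n} - {0} = {1..<n}" by auto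
    then have "(\<Sum>i<n. if i = 0 then 0 else ?y) = (\<Sum>i\<in>{1..<n}. ?y)"
      using n by (subst sum.remove[of _ 0]) auto
    then show ?thesis by (simp only: sum_constant card_atLeastLessThan)
  qed
  also have "\<dots> = 2 powr (2 - \<alpha>) * real (n - 1) powr (\<alpha> - 1)"
  proof -
    have "real (n - 1) powr (\<alpha> - 1) = real (n - 1) powr (1 + (\<alpha> - 2))"
      by simp
    also have "\<dots> = real (n - 1) * real (n - 1) powr (\<alpha> - 2)"
      using n by (subst powr_add) auto
    finally have "real (n - 1) powr (\<alpha> - 1) = real (n - 1) * real (n - 1) powr (\<alpha> - 2)" .
    moreover have "2 powr (2 - \<alpha>) = 1 / (2::real) powr (\<alpha> - 2)"
      by (simp add: powr_minus_divide[symmetric])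
    ultimately show ?thesis
      by (simp add: powr_divide)
  qed
  finally have tail: "(\<Sum>i<n. if i = 0 then 0 else ?y) = 2 powr (2 - \<alpha>) * real (n - 1) powr (\<alpha> - 1)" .
  have "(\<Sum>i<n. q ^ (n - i) * b i) \<le> (\<Sum>i<n. ?E * b i + (if i = 0 then 0 else ?y))"
    by (rule sum_mono) (use split in auto)
  also have "\<dots> = ?E * (\<Sum>i<n. b i) + 2 powr (2 - \<alpha>) * real (n - 1) powr (\<alpha> - 1)"
    by (simp only: sum.distrib sum_distrib_left tail)
  also have "\<dots> \<le> ?E * suminf b + 2 powr (2 - \<alpha>) * real (n - 1) powr (\<alpha> - 1)"
    by (intro add_right_mono mult_left_mono sum_le_suminf b_sum) (auto intro: b)
  finally show ?thesis
    by (simp add: mult.commute)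
qed

section \<open>Comparison with the constants \<open>C7\<close> and \<open>C8\<close>\<close>

lemma C8_alt:
  assumes "\<alpha> < 1" "0 < \<delta>"
  shows "C8 \<alpha> \<delta> t =
     (if exp (- \<delta> * t / 4) < 1 - 2 powr (\<alpha> - 1)
      then 1 / (1 - \<alpha>) * (2 powr (1 - \<alpha>) * (1 - exp (- \<delta> * t / 4)) - 1) else 0)"
proof -
  have pos: "0 < 1 - 2 powr (\<alpha> - 1)"
    using assms(1) powr_less_mono[of "\<alpha> - 1" 0 2] by simp
  \<comment> \<open>Exponentiating turns the threshold for \<open>t\<close> into one for the decay
    factor, on which alone \<open>C8\<close> then depends for given \<open>\<alpha>\<close>.\<close>
  have "t > - (4 / \<delta>) * ln (1 - 2 powr (\<alpha> - 1)) \<longleftrightarrow> - \<delta> * t / 4 < ln (1 - 2 powr (\<alpha> - 1))"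
    using assms(2) by (simp add: field_simps) linarith
  also have "\<dots> \<longleftrightarrow> exp (- \<delta> * t / 4) < 1 - 2 powr (\<alpha> - 1)"
    using pos by (metis exp_less_cancel_iff exp_ln)
  finally show ?thesis
    by (simp add: C8_def)
qed

text \<open>If \<open>E\<close> is below half the threshold in the definition of \<open>C8\<close>, then \<open>C8\<close> is bounded below;
  otherwise \<open>E\<close> is, and the algebraic term is absorbed into the exponential one.\<close>

lemma C7_C8_dominate:
  assumes \<alpha>: "0 < \<alpha>" "\<alpha> < 1"
  shows "\<exists>K>0. \<forall>\<delta> t E y. 0 < \<delta> \<longrightarrow> E = exp (- \<delta> * t / 4) \<longrightarrow> 0 \<le> y \<longrightarrow> y \<le> 1 \<longrightarrow>
    A * E + B * y \<le> K * (C7 \<alpha> \<delta> t * E + C8 \<alpha> \<delta> t * y)"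
proof -
  \<comment> \<open>As a function of \<open>E\<close>, the first branch of \<open>C8\<close> is
    affine, with value \<open>b\<close> at \<open>E = 0\<close> and zero at \<open>E = p\<close>;
    thus it equals \<open>b * (1 - E / p)\<close>.\<close>
  define p where "p = 1 - 2 powr (\<alpha> - 1)"
  define b where "b = (2 powr (1 - \<alpha>) - 1) / (1 - \<alpha>)"
  define c where "c = b / 2"
  have p: "0 < p"
    using \<alpha> powr_less_mono[of "\<alpha> - 1" 0 2] by (simp add: p_def)
  have c: "0 < c"
    using \<alpha> powr_less_mono[of 0 "1 - \<alpha>" 2] by (simp add: b_def c_def)
  have prod: "2 powr (1 - \<alpha>) * 2 powr (\<alpha> - 1) = (1::real)"
    by (simp add: powr_add[symmetric])
  \<comment> \<open>The summands pay in turn for positivity, for \<open>A * E\<close>, for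
    \<open>B * y\<close> when \<open>E > p / 2\<close>, and for \<open>B * y\<close> when
    \<open>E \<le> p / 2\<close>.\<close>
  define K where "K = 1 + \<bar>A\<bar> + \<bar>B\<bar> * 2 / p + \<bar>B\<bar> / c"
  have Kpos: "0 < K"
    unfolding K_def using p c by (intro add_pos_nonneg) auto
  have "A * E + B * y \<le> K * (C7 \<alpha> \<delta> t * E + C8 \<alpha> \<delta> t * y)"
    if \<delta>: "0 < \<delta>" and E: "E = exp (- \<delta> * t / 4)" and y: "0 \<le> y" "y \<le> 1" for \<delta> t E y
  proof -
    have E0: "0 < E" by (simp add: E)
    have C8: "C8 \<alpha> \<delta> t =
        (if E < p then 1 / (1 - \<alpha>) * (2 powr (1 - \<alpha>) * (1 - E) - 1) else 0)"
      unfolding E p_def by (rule C8_alt) fact+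
    have C8_ge: "2 * c * (1 - s) \<le> C8 \<alpha> \<delta> t" if "E \<le> s * p" "0 \<le> s" "s < 1" for s
    proof -
      have "s * p < 1 * p" using p that by (intro mult_strict_right_mono) auto
      then have "E < p" using that by linarith
      have "2 powr (1 - \<alpha>) * (1 - s * p) \<le> 2 powr (1 - \<alpha>) * (1 - E)"
        using that by (intro mult_left_mono) auto
      moreover have "2 powr (1 - \<alpha>) * (1 - s * p) = 2 powr (1 - \<alpha>) - s * 2 powr (1 - \<alpha>) + s"
        using prod by (simp add: p_def algebra_simps)
      moreover have "(2 powr (1 - \<alpha>) - 1) * (1 - s) =
          2 powr (1 - \<alpha>) - s * 2 powr (1 - \<alpha>) + s - 1"
        by (simp add: algebra_simps)
      ultimately have "(2 powr (1 - \<alpha>) - 1) * (1 - s) \<le> 2 powr (1 - \<alpha>) * (1 - E) - 1"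
        by linarith
      then have "(2 powr (1 - \<alpha>) - 1) * (1 - s) / (1 - \<alpha>)
          \<le> (2 powr (1 - \<alpha>) * (1 - E) - 1) / (1 - \<alpha>)"
        using \<alpha> by (intro divide_right_mono) auto
      moreover have "2 * c * (1 - s) = (2 powr (1 - \<alpha>) - 1) * (1 - s) / (1 - \<alpha>)"
      proof -
        have "2 * c = b" by (simp add: c_def)
        then show ?thesis by (simp add: b_def)
      qed
      ultimately show ?thesis
        using \<open>E < p\<close> by (simp add: C8)
    qed
    have C8_0: "0 \<le> C8 \<alpha> \<delta> t"
    proof (cases "E < p")
      case True
      \<comment> \<open>Here \<open>s = E / p\<close> in \<open>C8_ge\<close>; below,
        \<open>s = 1 / 2\<close> gives the uniform lower bound \<open>c\<close>.\<close>
      have "0 \<le> 2 * c * (1 - E / p)"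
        using True c p by simp
      also have "\<dots> \<le> C8 \<alpha> \<delta> t"
        using True E0 p by (intro C8_ge) auto
      finally show ?thesis .
    qed (simp add: C8)
    have "1 \<le> 2 / (1 - \<alpha>)" using \<alpha> by (simp add: field_simps)
    then have C7: "1 \<le> C7 \<alpha> \<delta> t"
      unfolding C7_def by (simp add: add_increasing2)
    have C7E: "E \<le> C7 \<alpha> \<delta> t * E" using C7 E0 by simp
    have "B * y \<le> \<bar>B\<bar> * y" using y by (intro mult_right_mono) auto
    also have "\<dots> \<le> (\<bar>B\<bar> * 2 / p) * E + (\<bar>B\<bar> / c) * (C8 \<alpha> \<delta> t * y)"
    proof (cases "E \<le> p / 2")
      case True
      then have "c \<le> C8 \<alpha> \<delta> t" using C8_ge[of "1 / 2"] by simp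
      then have "\<bar>B\<bar> * y \<le> \<bar>B\<bar> * y * (C8 \<alpha> \<delta> t / c)"
        using c y mult_left_mono[of 1 "C8 \<alpha> \<delta> t / c" "\<bar>B\<bar> * y"] by simp
      then show ?thesis using p E0 by (simp add: add_increasing mult_ac)
    next
      case False
      then have "1 \<le> 2 / p * E" using p by (simp add: field_simps)
      then have "y \<le> 2 / p * E" using y by linarith
      then have "\<bar>B\<bar> * y \<le> \<bar>B\<bar> * (2 / p * E)" by (intro mult_left_mono) auto
      then show ?thesis using c C8_0 y by (simp add: add_increasing2)
    qed
    finally have By: "B * y \<le> (\<bar>B\<bar> * 2 / p) * E + (\<bar>B\<bar> / c) * (C8 \<alpha> \<delta> t * y)" .
    have AE: "A * E \<le> \<bar>A\<bar> * E" using E0 by (intro mult_right_mono) auto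
    have "A * E + B * y \<le> (\<bar>A\<bar> + \<bar>B\<bar> * 2 / p) * E + (\<bar>B\<bar> / c) * (C8 \<alpha> \<delta> t * y)"
      using AE By by (simp add: distrib_right)
    also have "\<dots> \<le> K * E + K * (C8 \<alpha> \<delta> t * y)"
    proof (intro add_mono mult_right_mono)
      have "0 \<le> \<bar>B\<bar> * 2 / p" "0 \<le> \<bar>B\<bar> / c" using p c by auto
      then show "\<bar>A\<bar> + \<bar>B\<bar> * 2 / p \<le> K" "\<bar>B\<bar> / c \<le> K"
        unfolding K_def by linarith+
    qed (use E0 C8_0 y in auto)
    also have "\<dots> \<le> K * (C7 \<alpha> \<delta> t * E) + K * (C8 \<alpha> \<delta> t * y)"
      using C7E Kpos by (intro add_right_mono mult_left_mono) auto
    finally show ?thesis by (simp add: distrib_left)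
  qed
  with Kpos show ?thesis by blast
qed

section \<open>The error of the implicit Euler scheme\<close>

text \<open>Testing with \<open>e\<close>, coercivity makes the terms with \<open>g\<close> and
  \<open>\<kappa>\<close> contribute at most
  \<open>- \<tau> * (l - \<kappa>) * \<parallel>e\<parallel>\<^sup>2\<close>. Moved to the left,
  this gives the factor \<open>1 + \<tau> * (l - \<kappa>)\<close>, and one norm of \<open>e\<close>
  cancels.\<close>

lemma implicit_euler_energy_estimate:
  assumes L2: "e \<in> L2_space \<mu>" "e' \<in> L2_space \<mu>" "g \<in> L2_space \<mu>" "R \<in> L2_space \<mu>"
    and \<tau>: "0 < \<tau>" and eq: "AE x in \<mu>. (e x - e' x) / \<tau> = g x + \<kappa> * e x + R x"
    and coercive: "L2_inner \<mu> g e \<le> - l * (L2_norm \<mu> e)\<^sup>2" and \<kappa>: "\<kappa> < l"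
  shows "L2_norm \<mu> e \<le> 1 / (1 + \<tau> * (l - \<kappa>)) * (L2_norm \<mu> e' + \<tau> * L2_norm \<mu> R)"
proof -
  \<comment> \<open>\<open>?h\<close> is the scheme solved for the new value: \<open>e\<close>
    equals it almost everywhere.\<close>
  let ?c = "1 + \<tau> * (l - \<kappa>)" and ?h = "\<lambda>x. e' x + \<tau> * (g x + \<kappa> * e x + R x)"
  have c: "0 < ?c" using \<tau> \<kappa> by (simp add: add_pos_nonneg)
  have "?h \<in> L2_space \<mu>"
    by (intro L2_space_intros L2)
  moreover have "AE x in \<mu>. e x * e x = ?h x * e x"
    using eq by eventually_elim (use \<tau> in \<open>auto simp: field_simps\<close>)
  ultimately have "L2_inner \<mu> e e = L2_inner \<mu> ?h e"
    unfolding L2_inner_def using L2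
    by (intro integral_cong_AE borel_measurable_times L2_space_measurable)
  also have "\<dots> = L2_inner \<mu> e' e + \<tau> * (L2_inner \<mu> g e + \<kappa> * L2_inner \<mu> e e + L2_inner \<mu> R e)"
    by (simp add: L2 L2_inner_add_left L2_inner_scale_left L2_space_intros)
  also have "\<dots> \<le> L2_norm \<mu> e' * L2_norm \<mu> e
      + \<tau> * (- l * (L2_norm \<mu> e)\<^sup>2 + \<kappa> * (L2_norm \<mu> e)\<^sup>2 + L2_norm \<mu> R * L2_norm \<mu> e)"
    using L2_Cauchy_Schwarz[OF L2(2,1)] L2_Cauchy_Schwarz[OF L2(4,1)] coercive \<tau>
    unfolding L2_inner_self by (intro order_refl add_mono mult_left_mono) auto
  finally have "?c * (L2_norm \<mu> e)\<^sup>2 \<le> (L2_norm \<mu> e' + \<tau> * L2_norm \<mu> R) * L2_norm \<mu> e"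
    by (simp add: L2_inner_self algebra_simps)
  then have "(L2_norm \<mu> e)\<^sup>2 \<le> (1 / ?c * (L2_norm \<mu> e' + \<tau> * L2_norm \<mu> R)) * L2_norm \<mu> e"
    using c by (simp add: field_simps)
  then show ?thesis
    by (rule le_of_square_le_mult) (use c \<tau> in auto)
qed

text \<open>Weights of the local truncation errors: the step from \<open>i * \<tau>\<close> to \<open>(i + 1) * \<tau>\<close> contributes
  at most \<open>M * \<tau> powr \<alpha> * truncation_weight \<alpha> i\<close>.\<close>

definition truncation_weight :: "real \<Rightarrow> nat \<Rightarrow> real" where
  "truncation_weight \<alpha> i = (if i = 0 then 1 + 1 / \<alpha> else real i powr (\<alpha> - 2))"

lemma summable_truncation_weight:
  assumes "\<alpha> < 1"
  shows "summable (truncation_weight \<alpha>)"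
proof -
  have "eventually (\<lambda>i. truncation_weight \<alpha> i = real i powr (\<alpha> - 2)) sequentially"
    using eventually_gt_at_top[of 0] by eventually_elim (simp add: truncation_weight_def)
  then show ?thesis
    using assms by (simp add: summable_cong summable_real_powr_iff)
qed

text \<open>In the first step, which touches the singularity at 0, the increment and the derivative
  are bounded separately, contributing \<open>1 / \<alpha>\<close> and 1 to the weight. Later steps
  use the second derivative.\<close>

lemma truncation_error_bound:
  assumes \<alpha>: "0 < \<alpha>" "\<alpha> < 1" and M: "0 \<le> M"
    and cont: "L2_continuous_on \<mu> {0..T} v"
    and d1: "L2_has_derivative_on \<mu> {0<..T} v v'" and d2: "L2_has_derivative_on \<mu> {0<..T} v' v''"
    and b1: "\<And>t. 0 < t \<Longrightarrow> t \<le> T \<Longrightarrow> L2_norm \<mu> (v' t) \<le> M * t powr (\<alpha> - 1)"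
    and b2: "\<And>t. 0 < t \<Longrightarrow> t \<le> T \<Longrightarrow> L2_norm \<mu> (v'' t) \<le> M * t powr (\<alpha> - 2)"
    and \<tau>: "0 < \<tau>" and i: "real (Suc i) * \<tau> \<le> T"
  shows "\<tau> * L2_norm \<mu> (\<lambda>x. (v (real (Suc i) * \<tau>) x - v (real i * \<tau>) x) / \<tau> - v' (real (Suc i) * \<tau>) x)
    \<le> M * \<tau> powr \<alpha> * truncation_weight \<alpha> i"
proof (cases "i = 0")
  case True
  have \<tau>T: "\<tau> \<le> T" using i True by simp
  have L2: "v \<tau> \<in> L2_space \<mu>" "v 0 \<in> L2_space \<mu>" "v' \<tau> \<in> L2_space \<mu>"
    using cont d1 \<tau> \<tau>T by (auto simp: L2_continuous_on_def L2_has_derivative_on_def)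
  have "L2_norm \<mu> (\<lambda>x. (v \<tau> x - v 0 x) / \<tau> - v' \<tau> x)
      \<le> L2_norm \<mu> (\<lambda>x. v \<tau> x - v 0 x) / \<tau> + L2_norm \<mu> (v' \<tau>)"
    using L2_norm_diff_le[OF L2_space_divide[OF L2_space_diff[OF L2(1,2)]] L2(3), of \<tau>] \<tau>
    by (simp add: L2_norm_divide)
  also have "\<dots> \<le> M / \<alpha> * \<tau> powr \<alpha> / \<tau> + M * \<tau> powr (\<alpha> - 1)"
    using \<alpha> \<tau> \<tau>T M
    by (intro add_mono divide_right_mono L2_norm_increment_from_zero[OF cont d1] b1) auto
  also have "\<dots> = M * (\<tau> powr \<alpha> / \<tau>) * (1 + 1 / \<alpha>)"
    using \<tau> by (simp add: powr_diff add_divide_distrib algebra_simps)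
  finally show ?thesis
    using \<tau> True by (simp add: truncation_weight_def field_simps)
next
  case False
  let ?a = "real i * \<tau>" and ?b = "real (Suc i) * \<tau>"
  have ab: "0 < ?a" "?a < ?b" "?b - ?a = \<tau>"
    using False \<tau> by (auto simp: algebra_simps)
  have "L2_norm \<mu> (\<lambda>x. (v ?b x - v ?a x) / (?b - ?a) - v' ?b x) \<le> (?b - ?a) * (M * ?a powr (\<alpha> - 2))"
  proof (rule L2_backward_difference_remainder[OF d1 d2 ab(1,2) i])
    fix s assume s: "?a \<le> s" "s \<le> ?b"
    then have "L2_norm \<mu> (v'' s) \<le> M * s powr (\<alpha> - 2)"
      using ab i by (intro b2) auto
    \<comment> \<open>The exponent is negative, so the bound is largest at the left
      endpoint.\<close>
    also have "\<dots> \<le> M * ?a powr (\<alpha> - 2)"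
      using s ab \<alpha> M by (intro mult_left_mono powr_mono2') auto
    finally show "L2_norm \<mu> (v'' s) \<le> M * ?a powr (\<alpha> - 2)" .
  qed
  then have "\<tau> * L2_norm \<mu> (\<lambda>x. (v ?b x - v ?a x) / \<tau> - v' ?b x) \<le> \<tau> * (\<tau> * (M * ?a powr (\<alpha> - 2)))"
    using \<tau> unfolding ab(3) by (intro mult_left_mono) auto
  also have "\<dots> = M * \<tau> powr \<alpha> * real i powr (\<alpha> - 2)"
  proof -
    have "\<tau> powr \<alpha> = \<tau> powr (2 + (\<alpha> - 2))" by simp
    also have "\<dots> = \<tau> * \<tau> * \<tau> powr (\<alpha> - 2)"
      using \<tau> by (subst powr_add) (simp add: power2_eq_square)
    finally show ?thesis
      using \<tau> by (simp add: powr_mult mult_ac)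
  qed
  finally show ?thesis
    using False by (simp add: truncation_weight_def)
qed

text \<open>Subtracting the scheme from the equation at the new time level makes \<open>f\<close>
  cancel and leaves the truncation error as source. The energy estimate then yields a linear
  recursion for the error norms.\<close>

lemma implicit_euler_error_bound:
  assumes \<alpha>: "0 < \<alpha>" "\<alpha> < 1"
    and \<Omega>: "bounded_domain d \<Omega>" and basis: "dirichlet_eigenbasis d \<Omega> lam \<omega>"
    and T: "0 < T" and min: "minimal_dirichlet_eigenvalue d \<Omega> l" and \<kappa>: "\<kappa> < l"
    and sol: "parabolic_solution d \<Omega> T \<kappa> f u0 u D"
    and bound: "\<forall>k\<in>{1,2,3}. \<forall>t\<in>{0<..T}.
      L2_norm (lebesgue_dom d \<Omega>) (D k t) \<le> M * t powr (\<alpha> - real k)"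
    and N: "0 < N" and \<tau>: "\<tau> = T / real N"
    and euler: "implicit_euler d \<Omega> \<tau> N \<kappa> f u0 U"
    and n: "1 \<le> n" "n \<le> N"
  shows "0 \<le> M" and "L2_norm (lebesgue_dom d \<Omega>) (\<lambda>x. u (real n * \<tau>) x - U n x)
    \<le> M * \<tau> powr \<alpha> *
      (\<Sum>i<n. (1 / (1 + \<tau> * (l - \<kappa>))) ^ (n - i) * truncation_weight \<alpha> i)"
proof -
  let ?\<mu> = "lebesgue_dom d \<Omega>"
  define q where "q = 1 / (1 + \<tau> * (l - \<kappa>))"
  have \<tau>0: "0 < \<tau>" using \<tau> T N by simp
  have tT: "real i * \<tau> \<le> T" if "i \<le> N" for i
    using that T N by (simp add: \<tau> field_simps)
  have q0: "0 \<le> q" using \<tau>0 \<kappa> by (simp add: q_def)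
  \<comment> \<open>A norm bounded by \<open>M\<close> times a positive power forces
    \<open>M\<close> to be nonnegative.\<close>
  have "L2_norm ?\<mu> (D 1 T) \<le> M * T powr (\<alpha> - 1)"
    using bound T by force
  then have "0 \<le> M * T powr (\<alpha> - 1)"
    using L2_norm_nonneg order_trans by blast
  then show M: "0 \<le> M"
    using T by (simp add: zero_le_mult_iff)
  have cont: "L2_continuous_on ?\<mu> {0..T} u"
    using sol by (simp add: parabolic_solution_def)
  have d1: "L2_has_derivative_on ?\<mu> {0<..T} u (D 1)"
    and d2: "L2_has_derivative_on ?\<mu> {0<..T} (D 1) (D 2)"
  proof -
    have der: "L2_time_derivatives ?\<mu> {0<..T} 3 u D"
      using sol by (simp add: parabolic_solution_def)
    then have "L2_has_derivative_on ?\<mu> {0<..T} (D 0) (D (Suc 0))"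
      "L2_has_derivative_on ?\<mu> {0<..T} (D 1) (D (Suc 1))"
      unfolding L2_time_derivatives_def by force+
    with der show "L2_has_derivative_on ?\<mu> {0<..T} u (D 1)"
      "L2_has_derivative_on ?\<mu> {0<..T} (D 1) (D 2)"
      by (simp_all add: L2_time_derivatives_def numeral_2_eq_2)
  qed
  text \<open>\<open>U 0\<close> agrees with \<open>u 0\<close> only almost everywhere and is replaced by it.\<close>
  define V where "V i = (if i = 0 then u 0 else U i)" for i
  define e where "e i = (\<lambda>x. u (real i * \<tau>) x - V i x)" for i
  have U0: "AE x in ?\<mu>. U 0 x = u 0 x"
  proof -
    have "AE x in ?\<mu>. U 0 x = u0 x" "AE x in ?\<mu>. u 0 x = u0 x"
      using sol euler by (simp_all add: parabolic_solution_def implicit_euler_def)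
    then show ?thesis by eventually_elim simp
  qed
  have u_L2: "u (real i * \<tau>) \<in> L2_space ?\<mu>" if "i \<le> N" for i
    using cont tT[OF that] \<tau>0 by (simp add: L2_continuous_on_def)
  have lapU: "\<exists>\<Delta>U. dirichlet_laplacian d \<Omega> (U i) \<Delta>U \<and> (AE x in ?\<mu>.
      (U i x - U (i - 1) x) / \<tau> = \<Delta>U x + \<kappa> * U i x + f (real i * \<tau>) x)"
    if "1 \<le> i" "i \<le> N" for i
    using euler that by (simp add: implicit_euler_def)
  have e_L2: "e i \<in> L2_space ?\<mu>" if "i \<le> N" for i
  proof (cases "i = 0")
    case True
    then show ?thesis by (simp add: e_def V_def L2_space_zero)
  next
    case False
    then obtain \<Delta>U where "dirichlet_laplacian d \<Omega> (U i) \<Delta>U"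
      using lapU[of i] \<open>i \<le> N\<close> by force
    from L2_space_diff[OF u_L2[OF that] dirichlet_laplacian_L2(1)[OF this]] show ?thesis
      using False by (simp add: e_def V_def)
  qed
  have step: "L2_norm ?\<mu> (e (Suc i))
      \<le> q * (L2_norm ?\<mu> (e i) + M * \<tau> powr \<alpha> * truncation_weight \<alpha> i)" if i: "i < N" for i
  proof -
    let ?t = "real (Suc i) * \<tau>"
    define R where "R = (\<lambda>x. (u ?t x - u (real i * \<tau>) x) / \<tau> - D 1 ?t x)"
    have t: "0 < ?t" "?t \<le> T"
      using \<tau>0 tT[of "Suc i"] i by simp_all
    then have "?t \<in> {0<..T}"
      by simp
    then obtain \<Delta>u where lapu: "dirichlet_laplacian d \<Omega> (u ?t) \<Delta>u"
      and equ: "AE x in ?\<mu>. D 1 ?t x - \<Delta>u x = \<kappa> * u ?t x + f ?t x"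
      using sol unfolding parabolic_solution_def by blast
    obtain \<Delta>U where lapU': "dirichlet_laplacian d \<Omega> (U (Suc i)) \<Delta>U"
      and eqU: "AE x in ?\<mu>. (U (Suc i) x - U i x) / \<tau> = \<Delta>U x + \<kappa> * U (Suc i) x + f ?t x"
      using lapU[of "Suc i"] i by auto
    have eqV: "AE x in ?\<mu>. (V (Suc i) x - V i x) / \<tau> = \<Delta>U x + \<kappa> * V (Suc i) x + f ?t x"
      using eqU U0 by eventually_elim (cases "i = 0", auto simp: V_def)
    have D1: "D 1 ?t \<in> L2_space ?\<mu>"
      using d1 t by (simp add: L2_has_derivative_on_def)
    have R_L2: "R \<in> L2_space ?\<mu>"
      unfolding R_def using i by (intro L2_space_intros u_L2 D1) auto
    have "L2_norm ?\<mu> (e (Suc i)) \<le> 1 / (1 + \<tau> * (l - \<kappa>)) *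
        (L2_norm ?\<mu> (e i) + \<tau> * L2_norm ?\<mu> R)"
    proof (rule implicit_euler_energy_estimate)
      show "(\<lambda>x. \<Delta>u x - \<Delta>U x) \<in> L2_space ?\<mu>"
        by (intro L2_space_diff dirichlet_laplacian_L2[OF lapu] dirichlet_laplacian_L2[OF lapU'])
      show "AE x in ?\<mu>. (e (Suc i) x - e i x) / \<tau> = \<Delta>u x - \<Delta>U x + \<kappa> * e (Suc i) x + R x"
        using equ eqV
        by eventually_elim (simp add: e_def R_def diff_divide_distrib right_diff_distrib)
      show "L2_inner ?\<mu> (\<lambda>x. \<Delta>u x - \<Delta>U x) (e (Suc i)) \<le> - l * (L2_norm ?\<mu> (e (Suc i)))\<^sup>2"
        using dirichlet_laplacian_coercive[OF \<Omega> basis min lapu lapU']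
        by (simp add: e_def V_def)
    qed (use e_L2 R_L2 \<tau>0 \<kappa> i in auto)
    also have "\<dots> \<le> q * (L2_norm ?\<mu> (e i) + M * \<tau> powr \<alpha> * truncation_weight \<alpha> i)"
      unfolding q_def[symmetric]
    proof (intro mult_left_mono add_left_mono q0)
      show "\<tau> * L2_norm ?\<mu> R \<le> M * \<tau> powr \<alpha> * truncation_weight \<alpha> i"
        unfolding R_def
      proof (rule truncation_error_bound[OF \<alpha> M cont d1 d2 _ _ \<tau>0 t(2)])
        fix t assume "0 < t" "t \<le> T"
        then show "L2_norm ?\<mu> (D 1 t) \<le> M * t powr (\<alpha> - 1)" "L2_norm ?\<mu> (D 2 t) \<le> M * t powr (\<alpha> - 2)"
          using bound by force+
      qed
    qed
    finally show ?thesis .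
  qed
  have "L2_norm ?\<mu> (e n) \<le> (\<Sum>i<n. q ^ (n - i) * (M * \<tau> powr \<alpha> * truncation_weight \<alpha> i))"
  proof (rule linear_recursion_bound[OF q0])
    \<comment> \<open>With \<open>V 0 = u 0\<close>, the function \<open>e 0\<close> vanishes
      identically.\<close>
    show "L2_norm ?\<mu> (e 0) \<le> 0"
      by (simp add: e_def V_def L2_norm_def)
  qed (use step n in auto)
  also have "\<dots> = M * \<tau> powr \<alpha> * (\<Sum>i<n. q ^ (n - i) * truncation_weight \<alpha> i)"
    by (simp add: sum_distrib_left mult_ac)
  finally show "L2_norm ?\<mu> (\<lambda>x. u (real n * \<tau>) x - U n x) \<le> M * \<tau> powr \<alpha> *
      (\<Sum>i<n. (1 / (1 + \<tau> * (l - \<kappa>))) ^ (n - i) * truncation_weight \<alpha> i)"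
    using n by (simp add: e_def V_def q_def)
qed

theorem theorem3p1:
  fixes \<alpha> M :: real
  assumes "0 < \<alpha>" and "\<alpha> < 1"
  shows "\<exists>C>0. \<forall>(d::nat) (\<Omega>::(nat \<Rightarrow> real) set) (T::real) (\<kappa>::real) (lam1::real) f u0 u D
            (N::nat) (\<tau>::real) U.
      1 \<le> d \<longrightarrow>
      bounded_domain d \<Omega> \<longrightarrow>
      (\<exists>lam \<omega>. dirichlet_eigenbasis d \<Omega> lam \<omega>) \<longrightarrow>
      0 < T \<longrightarrow>
      0 < lam1 \<longrightarrow>
      minimal_dirichlet_eigenvalue d \<Omega> lam1 \<longrightarrow>
      \<kappa> < lam1 \<longrightarrow>
      parabolic_solution d \<Omega> T \<kappa> f u0 u D \<longrightarrow>
      (\<forall>k\<in>{1,2,3}. \<forall>t\<in>{0<..T}.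
         L2_norm (lebesgue_dom d \<Omega>) (D k t) \<le> M * t powr (\<alpha> - real k)) \<longrightarrow>
      2 \<le> N \<longrightarrow>
      \<tau> = T / real N \<longrightarrow>
      implicit_euler d \<Omega> \<tau> N \<kappa> f u0 U \<longrightarrow>
      \<tau> < 1 / (lam1 - \<kappa>) \<longrightarrow>
      (\<forall>n. 2 \<le> n \<and> n \<le> N \<longrightarrow>
         L2_norm (lebesgue_dom d \<Omega>) (\<lambda>x. u (real n * \<tau>) x - U n x)
           \<le> exp (- (lam1 - \<kappa>) * (real n * \<tau>) / 2)
                 * L2_norm (lebesgue_dom d \<Omega>) (\<lambda>x. u 0 x - U 0 x)
             + C * (C7 \<alpha> (lam1 - \<kappa>) (real n * \<tau>)
                        * exp (- (lam1 - \<kappa>) * (real n * \<tau>) / 4) * \<tau> powr \<alpha>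
                    + C8 \<alpha> (lam1 - \<kappa>) (real n * \<tau>)
                        * (real (n - 1) * \<tau>) powr (\<alpha> - 1) * \<tau>))"
proof -
  let ?Z = "suminf (truncation_weight \<alpha>)" and ?B = "2 powr (2 - \<alpha>) :: real"
  obtain K where K: "0 < K" and dominate: "\<And>\<delta> t E y. \<lbrakk>0 < \<delta>; E = exp (- \<delta> * t / 4); 0 \<le> y; y \<le> 1\<rbrakk> \<Longrightarrow>
      ?Z * E + ?B * y \<le> K * (C7 \<alpha> \<delta> t * E + C8 \<alpha> \<delta> t * y)"
    using C7_C8_dominate[OF assms, of ?Z ?B] by blast
  \<comment> \<open>\<open>K\<close> depends only on \<open>\<alpha>\<close>. The factor
    \<open>\<bar>M\<bar> + 1\<close> keeps \<open>C\<close> positive for every real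
    \<open>M\<close>.\<close>
  define C where "C = (\<bar>M\<bar> + 1) * K"
  have "L2_norm (lebesgue_dom d \<Omega>) (\<lambda>x. u (real n * \<tau>) x - U n x)
      \<le> exp (- (lam1 - \<kappa>) * (real n * \<tau>) / 2)
            * L2_norm (lebesgue_dom d \<Omega>) (\<lambda>x. u 0 x - U 0 x)
        + C * (C7 \<alpha> (lam1 - \<kappa>) (real n * \<tau>)
                   * exp (- (lam1 - \<kappa>) * (real n * \<tau>) / 4) * \<tau> powr \<alpha>
               + C8 \<alpha> (lam1 - \<kappa>) (real n * \<tau>)
                   * (real (n - 1) * \<tau>) powr (\<alpha> - 1) * \<tau>)"
    if \<Omega>: "bounded_domain d \<Omega>" and basis: "dirichlet_eigenbasis d \<Omega> lam \<omega>"
      and T: "0 < T" and min: "minimal_dirichlet_eigenvalue d \<Omega> lam1" and \<kappa>: "\<kappa> < lam1"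
      and sol: "parabolic_solution d \<Omega> T \<kappa> f u0 u D"
      and bound: "\<forall>k\<in>{1,2,3}. \<forall>t\<in>{0<..T}.
        L2_norm (lebesgue_dom d \<Omega>) (D k t) \<le> M * t powr (\<alpha> - real k)"
      and N: "2 \<le> N" and \<tau>: "\<tau> = T / real N"
      and euler: "implicit_euler d \<Omega> \<tau> N \<kappa> f u0 U"
      and small: "\<tau> < 1 / (lam1 - \<kappa>)" and n: "2 \<le> n" "n \<le> N"
    for d \<Omega> T \<kappa> lam1 lam \<omega> f u0 u D N \<tau> U n
  proof -
    let ?\<mu> = "lebesgue_dom d \<Omega>"
    define \<delta> where "\<delta> = lam1 - \<kappa>"
    define E where "E = exp (- \<delta> * (real n * \<tau>) / 4)"
    define y where "y = real (n - 1) powr (\<alpha> - 1)"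
    define X where "X = C7 \<alpha> \<delta> (real n * \<tau>) * E + C8 \<alpha> \<delta> (real n * \<tau>) * y"
    have \<tau>0: "0 < \<tau>" using T N \<tau> by simp
    have \<delta>: "0 < \<delta>" using \<kappa> by (simp add: \<delta>_def)
    have y: "0 \<le> y" "y \<le> 1"
      using n assms powr_mono2'[of "1 - \<alpha>" 1 "real (n - 1)"]
      by (auto simp: y_def powr_minus_divide[of _ "1 - \<alpha>", simplified] ge_one_powr_ge_zero)
    have \<tau>\<delta>: "0 \<le> \<tau> * \<delta>" "\<tau> * \<delta> \<le> 1"
      using \<tau>0 \<delta> small by (simp_all add: \<delta>_def field_simps)
    have M: "0 \<le> M" and error: "L2_norm ?\<mu> (\<lambda>x. u (real n * \<tau>) x - U n x) \<le> M * \<tau> powr \<alpha> *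
        (\<Sum>i<n. (1 / (1 + \<tau> * \<delta>)) ^ (n - i) * truncation_weight \<alpha> i)"
      unfolding \<delta>_def using N n
      by (intro implicit_euler_error_bound[OF assms \<Omega> basis T min \<kappa> sol bound _ \<tau> euler]; simp)+
    have "(\<Sum>i<n. (1 / (1 + \<tau> * \<delta>)) ^ (n - i) * truncation_weight \<alpha> i)
        \<le> ?Z * exp (- (\<tau> * \<delta> * real n) / 4) + ?B * real (n - 1) powr (\<alpha> - 1)"
      using \<tau>\<delta> n assms inverse_1plus_le_exp[OF \<tau>\<delta>]
      by (intro geometric_weighted_powr_sum_le summable_truncation_weight)
        (auto simp: truncation_weight_def)
    also have "\<dots> = ?Z * E + ?B * y"
      by (simp add: E_def y_def mult_ac)
    also have "\<dots> \<le> K * X"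
      unfolding X_def by (rule dominate[OF \<delta> E_def y])
    finally have sum_le: "(\<Sum>i<n. (1 / (1 + \<tau> * \<delta>)) ^ (n - i) * truncation_weight \<alpha> i) \<le> K * X" .
    moreover have "0 \<le> (\<Sum>i<n. (1 / (1 + \<tau> * \<delta>)) ^ (n - i) * truncation_weight \<alpha> i)"
      using \<tau>\<delta> assms by (intro sum_nonneg mult_nonneg_nonneg) (auto simp: truncation_weight_def)
    \<comment> \<open>This sign allows \<open>M\<close> to be enlarged to
      \<open>\<bar>M\<bar> + 1\<close> below.\<close>
    ultimately have KX: "0 \<le> K * X" by linarith
    note error
    also have "M * \<tau> powr \<alpha> * (\<Sum>i<n. (1 / (1 + \<tau> * \<delta>)) ^ (n - i) * truncation_weight \<alpha> i)
        \<le> M * \<tau> powr \<alpha> * (K * X)"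
      using M by (intro mult_left_mono sum_le) auto
    also have "\<dots> \<le> (\<bar>M\<bar> + 1) * \<tau> powr \<alpha> * (K * X)"
      using KX by (intro mult_right_mono) auto
    also have "\<dots> = C * (C7 \<alpha> \<delta> (real n * \<tau>) * E * \<tau> powr \<alpha>
        + C8 \<alpha> \<delta> (real n * \<tau>) * (real (n - 1) * \<tau>) powr (\<alpha> - 1) * \<tau>)"
    proof -
      \<comment> \<open>Both terms of the claimed bound thus share the factor
        \<open>\<tau> powr \<alpha>\<close>.\<close>
      have "(real (n - 1) * \<tau>) powr (\<alpha> - 1) * \<tau> = y * \<tau> powr \<alpha>"
        using \<tau>0 by (simp add: y_def powr_mult powr_diff)
      then have C8_term: "C8 \<alpha> \<delta> (real n * \<tau>) * (real (n - 1) * \<tau>) powr (\<alpha> - 1) * \<tau>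
          = C8 \<alpha> \<delta> (real n * \<tau>) * (y * \<tau> powr \<alpha>)"
        by (simp only: mult.assoc)
      show ?thesis
        unfolding C8_term
        by (simp add: C_def X_def algebra_simps)
    qed
    \<comment> \<open>The term with the initial error is nonnegative and is added on the
      right.\<close>
    finally show ?thesis
      unfolding E_def \<delta>_def by (simp add: add_increasing)
  qed
  moreover have "0 < C" using K by (simp add: C_def)
  ultimately show ?thesis
    by (intro exI[of _ C] conjI allI impI; (elim exE conjE)?) blast+
qed

end
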